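(* Suppose $n$ is a positive rational number, $t\ge -1$ is an integer, and $P=(\theta_t-1,y)\in E_n(K_t)$. Then $P$ has infinite order and $$\operatorname{rank} E_n(K_t)\ge \operatorname{rank} E_n(\mathbb{Q})+2.$$ The conjugates $P,\sigma P,\sigma^2P$ generate a subgroup of $E_n(K_t)$ of rank two if $\operatorname{Tr}(P)=O$, and of rank three otherwise.
   Context: For an integer $t\ge -1$, let $g_t(X)=X^3-tX^2-(t+3)X-1$, let $\theta_t$ be the largest real root of $g_t$, and let $K_t=\mathbb{Q}(\theta_t)$. The polynomial $g_t$ is irreducible over $\mathbb{Q}$ with three real roots, and $K_t/\mathbb{Q}$ is a cyclic cubic extension; let $\sigma$ be the generator of $\operatorname{Gal}(K_t/\mathbb{Q})$ with $\sigma(\theta_t)=-1/(\theta_t+1)$. For a positive rational number $n$, $E_n$ is the elliptic curve $y^2=x^3-n^2x$ over $\mathbb{Q}$, with identity element $O$. For $P\in E_n(K_t)$, the trace is $\operatorname{Tr}(P)=P+\sigma P+\sigma^2P\in E_n(\mathbb{Q})$ (sum in the group law of $E_n$). *)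

theory Defs
  imports
    Complex_Main
    "HOL-Library.Extended_Nat"
    "HOL-Algebra.Generated_Fields"
    "HOL-Algebra.Multiplicative_Group"
    "HOL-Algebra.Bij"
    "HOL-Algebra.Algebraic_Closure_Type"
begin

section \<open>Rank of an abelian group\<close>

definition int_independent :: "('a, 'b) monoid_scheme \<Rightarrow> 'a set \<Rightarrow> bool" where
  "int_independent G S \<longleftrightarrow>
     finite S \<and> S \<subseteq> carrier G \<and>
     (\<forall>c :: 'a \<Rightarrow> int.
        finprod G (\<lambda>a. a [^]\<^bsub>G\<^esub> c a) S = \<one>\<^bsub>G\<^esub> \<longrightarrow> (\<forall>a\<in>S. c a = 0))"

text \<open>The rank is valued in \<open>enat\<close>, so that it is meaningful without knowing in advance that
  the group is finitely generated; for finitely generated groups it is the usual rank.\<close>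

definition ab_rank :: "('a, 'b) monoid_scheme \<Rightarrow> enat" where
  "ab_rank G = (SUP S \<in> {S. int_independent G S}. enat (card S))"


section \<open>Elliptic curves in short Weierstrass form\<close>

text \<open>\<open>Infinity\<close> is the identity element \<open>O\<close>. The map function \<open>map_ec_point\<close> that comes with the
  datatype is the coordinatewise action of a field automorphism on points.\<close>

datatype 'a ec_point = Infinity | Affine 'a 'a

definition on_curve :: "'a::field_char_0 \<Rightarrow> 'a \<Rightarrow> 'a ec_point \<Rightarrow> bool" where
  "on_curve a b P \<longleftrightarrow>
     (case P of Infinity \<Rightarrow> True | Affine x y \<Rightarrow> y\<^sup>2 = x ^ 3 + a * x + b)"

text \<open>Chord-tangent addition on \<open>y\<^sup>2 = x\<^sup>3 + a x + b\<close>. The slope \<open>m\<close> is that of the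
  tangent if the two points coincide, which for points of the curve is the only remaining possibility
  when \<open>x1 = x2\<close> and \<open>y1 \<noteq> - y2\<close>. The coefficient \<open>b\<close> does not enter the formula.\<close>

fun ec_add :: "'a::field_char_0 \<Rightarrow> 'a ec_point \<Rightarrow> 'a ec_point \<Rightarrow> 'a ec_point" where
  "ec_add a Infinity Q = Q"
| "ec_add a P Infinity = P"
| "ec_add a (Affine x1 y1) (Affine x2 y2) =
     (if x1 = x2 \<and> y1 = - y2 then Infinity
      else let m = (if x1 = x2 then (3 * x1\<^sup>2 + a) / (2 * y1) else (y2 - y1) / (x2 - x1));
               x3 = m\<^sup>2 - x1 - x2
           in Affine x3 (m * (x1 - x3) - y1))"

text \<open>The group of points with coordinates in a subfield \<open>F\<close>, written multiplicatively.\<close>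

definition ec_group :: "'a::field_char_0 \<Rightarrow> 'a \<Rightarrow> 'a set \<Rightarrow> 'a ec_point monoid" where
  "ec_group a b F =
     \<lparr>carrier = {P. on_curve a b P \<and> set_ec_point P \<subseteq> F},
      monoid.mult = ec_add a,
      one = Infinity\<rparr>"

definition congruent_curve :: "rat \<Rightarrow> real set \<Rightarrow> real ec_point monoid" where
  "congruent_curve n F = ec_group (- (of_rat n)\<^sup>2) 0 F"


section \<open>The simplest cubic fields\<close>

abbreviation real_ring :: "real ring" where
  "real_ring \<equiv> ring_of_type_algebra"

definition theta :: "int \<Rightarrow> real" where
  "theta t = Max {x :: real. x ^ 3 - of_int t * x\<^sup>2 - (of_int t + 3) * x - 1 = 0}"

definition cubic_field :: "int \<Rightarrow> real set" where
  "cubic_field t = generate_field real_ring {theta t}"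

text \<open>\<open>Gal(K/F)\<close> for subfields \<open>F \<subseteq> K\<close> of the reals. Elements of \<open>Bij K\<close> are extensional, that is
  \<open>undefined\<close> outside \<open>K\<close>, so that an automorphism of \<open>K\<close> is represented by a unique function.\<close>

definition galois_group :: "real set \<Rightarrow> real set \<Rightarrow> (real \<Rightarrow> real) monoid" where
  "galois_group K F = (BijGroup K)
     \<lparr>carrier := {s \<in> Bij K.
        s \<in> ring_hom (real_ring\<lparr>carrier := K\<rparr>) (real_ring\<lparr>carrier := K\<rparr>) \<and> (\<forall>x\<in>F. s x = x)}\<rparr>"

definition sigma :: "int \<Rightarrow> real \<Rightarrow> real" where
  "sigma t = (THE s.
     s \<in> carrier (galois_group (cubic_field t) \<rat>) \<and>
     generate (galois_group (cubic_field t) \<rat>) {s} = carrier (galois_group (cubic_field t) \<rat>) \<and>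
     s (theta t) = - 1 / (theta t + 1))"

definition conjugate :: "int \<Rightarrow> real ec_point \<Rightarrow> real ec_point" where
  "conjugate t P = map_ec_point (sigma t) P"

definition trace :: "rat \<Rightarrow> int \<Rightarrow> real ec_point \<Rightarrow> real ec_point" where
  "trace n t P =
     (let E = congruent_curve n (cubic_field t)
      in P \<otimes>\<^bsub>E\<^esub> conjugate t P \<otimes>\<^bsub>E\<^esub> conjugate t (conjugate t P))"

end

theory Submission
  imports Defs
begin

text \<open>
  The torsion of \<open>E\<^sub>n(K\<^sub>t)\<close> is \<open>E\<^sub>n[2]\<close>, for a 2-adic reason. Modulo 2 the polynomial \<open>g\<^sub>t\<close> is
  \<open>x^3 + x + 1\<close> or \<open>x^3 + x^2 + 1\<close>, both irreducible, so 2 is inert in \<open>K\<^sub>t\<close> and the 2-adic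
  valuation \<open>v\<close> extends to \<open>K\<^sub>t\<close> with integral values. With \<open>u = x/n\<close>, doubling a point acts by
  \<open>u \<mapsto> (u^2 + 1)^2 / (4 u (u^2 - 1))\<close>. The new value always satisfies \<open>v < 0\<close>, and once \<open>v(u) < 0\<close>
  each doubling lowers it further (\<open>V_doubling\<close>). So the points \<open>2^j Q\<close> are distinct
  whenever \<open>Q\<close> is affine with \<open>y \<noteq> 0\<close> (\<open>infinite_order\<close>). In particular all torsion points are fixed by
  \<open>\<sigma>\<close> and killed by 2, whereas \<open>P\<close> is not fixed.

  The difference \<open>D = P - \<sigma>P\<close> has trace zero; were it torsion, it would be fixed by \<open>\<sigma>\<close>, hence \<open>3D = 2D = O\<close>
  and \<open>P = \<sigma>P\<close>. On the elements of trace zero the group ring of \<open>\<langle>\<sigma>\<rangle>\<close> acts through \<open>\<int>[\<omega>]\<close>, where a nonzero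
  \<open>a + b\<omega>\<close> has the nonzero norm \<open>a^2 - ab + b^2\<close>; so \<open>D\<close> and \<open>\<sigma>D\<close> are independent, also modulo the points
  fixed by \<open>\<sigma>\<close>. This gives the growth of the rank by two, and rank two for the span of the conjugates of \<open>P\<close> if
  \<open>Tr(P) = O\<close>. Their span has rank three as soon as \<open>Tr(P)\<close> has infinite order, so it remains to see that
  \<open>Tr(P)\<close> is not a point \<open>(e0, 0)\<close> of order two (\<open>trace_not_two_torsion\<close>).

  This is a 2-descent. If \<open>Tr(P) = (e0, 0)\<close> then for \<open>e \<in> {0, n, -n}\<close> the product of \<open>e0 - e\<close> and the
  norm of \<open>\<theta> - 1 - e\<close> is a square in \<open>K\<^sub>t\<close>. Since the norm of \<open>\<theta> - 1\<close> is \<open>2t + 3 > 0\<close>, signs exclude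
  \<open>e0 = -n\<close> (take \<open>e = 0\<close>) and \<open>e0 = 0\<close> (combine \<open>e = n\<close> and \<open>e = -n\<close> with the
  equation of the curve at \<open>P\<close>). For \<open>e0 = n\<close>, the choice
  \<open>e = 0\<close> shows that \<open>v(n)\<close> is even, and \<open>e = -n\<close> that \<open>1 + v(n) + 3 min(v(n), 0)\<close> is even, which is absurd.

  The group law is established along the way. Its associativity reduces, for three points with slopes \<open>m\<close>, \<open>k\<close> of
  the lines through the first and the last two, to the identity \<open>\<alpha> (\<mu> + m) = 1\<close> of \<open>assoc_slope\<close>, where
  \<open>\<mu>\<close> is the slope used in the second addition and \<open>\<alpha>\<close> the leading coefficient of the parabola through the points.
\<close>

section \<open>The group law\<close>

fun ec_neg :: "'a::field_char_0 ec_point \<Rightarrow> 'a ec_point" where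
  "ec_neg Infinity = Infinity"
| "ec_neg (Affine x y) = Affine x (- y)"

text \<open>The slope of the line through two points of \<open>y\<^sup>2 = x ^ 3 + a * x + b\<close>, as a polynomial condition that
  covers secants and tangents alike: for points with \<open>x1 \<noteq> x2\<close> the second equation follows from the first, for
  equal points with \<open>y1 \<noteq> 0\<close> the first is trivial and the second determines \<open>m\<close>.\<close>

definition ec_slope :: "'a::field_char_0 \<Rightarrow> 'a \<Rightarrow> 'a \<Rightarrow> 'a \<Rightarrow> 'a \<Rightarrow> 'a \<Rightarrow> bool" where
  "ec_slope a x1 y1 x2 y2 m \<longleftrightarrow>
     y2 - y1 = m * (x2 - x1) \<and> m * (y1 + y2) = x1\<^sup>2 + x1 * x2 + x2\<^sup>2 + a"

lemma ec_add_slope: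
  assumes "ec_slope a x1 y1 x2 y2 m" and "\<not> (x1 = x2 \<and> y1 = - y2)"
  shows "ec_add a (Affine x1 y1) (Affine x2 y2) =
    Affine (m\<^sup>2 - x1 - x2) (m * (x1 - (m\<^sup>2 - x1 - x2)) - y1)"
proof (cases "x1 = x2")
  case True
  with assms have y: "y2 = y1" "y1 \<noteq> 0" and m: "m * (2 * y1) = 3 * x1\<^sup>2 + a"
    by (auto simp: ec_slope_def power2_eq_square algebra_simps)
  have "(3 * x1\<^sup>2 + a) / (2 * y1) = m" using y m by (simp add: field_simps)
  with True y assms(2) show ?thesis by (simp add: Let_def)
next
  case False
  hence "(y2 - y1) / (x2 - x1) = m" using assms(1) by (simp add: ec_slope_def field_simps)
  with False show ?thesis by (simp add: Let_def)
qed

lemma ec_slope_exists: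
  assumes P: "y1\<^sup>2 = x1 ^ 3 + a * x1 + b" and Q: "y2\<^sup>2 = x2 ^ 3 + a * x2 + b"
    and "\<not> (x1 = x2 \<and> y1 = - y2)"
  obtains m where "ec_slope a x1 y1 x2 y2 m"
    and "ec_add a (Affine x1 y1) (Affine x2 y2) =
      Affine (m\<^sup>2 - x1 - x2) (m * (x1 - (m\<^sup>2 - x1 - x2)) - y1)"
    and "m = (if x1 = x2 then (3 * x1\<^sup>2 + a) / (2 * y1) else (y2 - y1) / (x2 - x1))"
proof -
  define m where "m = (if x1 = x2 then (3 * x1\<^sup>2 + a) / (2 * y1) else (y2 - y1) / (x2 - x1))"
  have "ec_slope a x1 y1 x2 y2 m"
  proof (cases "x1 = x2")
    case True
    hence "y1\<^sup>2 = y2\<^sup>2" using P Q by simp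
    hence y: "y2 = y1" "y1 \<noteq> 0" using assms(3) True by (auto simp: power2_eq_iff)
    thus ?thesis using True by (simp add: ec_slope_def m_def field_simps power2_eq_square)
  next
    case False
    hence m: "y2 - y1 = m * (x2 - x1)" by (simp add: m_def)
    have "(x2 - x1) * (m * (y1 + y2)) = (y2 - y1) * (y1 + y2)" using m by simp
    also have "\<dots> = y2\<^sup>2 - y1\<^sup>2" by (simp add: power2_eq_square algebra_simps)
    also have "\<dots> = (x2 - x1) * (x1\<^sup>2 + x1 * x2 + x2\<^sup>2 + a)"
      unfolding P Q by (simp add: power2_eq_square power3_eq_cube algebra_simps)
    finally show ?thesis using False m by (simp add: ec_slope_def)
  qed
  from this ec_add_slope[OF this assms(3)] m_def show thesis by (rule that)
qed

lemma ec_slope_sym: "ec_slope a x1 y1 x2 y2 m \<Longrightarrow> ec_slope a x2 y2 x1 y1 m"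
  unfolding ec_slope_def by (auto simp: algebra_simps)

lemma cubic_minus_line:
  fixes a :: "'a::field_char_0"
  assumes "y1\<^sup>2 = x1 ^ 3 + a * x1 + b" and "ec_slope a x1 y1 x2 y2 m"
  shows "x ^ 3 + a * x + b = (y1 + m * (x - x1))\<^sup>2 + (x - x1) * (x - x2) * (x - (m\<^sup>2 - x1 - x2))"
proof -
  have b: "b = y1\<^sup>2 - x1 ^ 3 - a * x1"
    and a: "a = m * (y1 + y2) - x1\<^sup>2 - x1 * x2 - x2\<^sup>2" and y2: "y2 = y1 + m * (x2 - x1)"
    using assms by (simp_all add: ec_slope_def algebra_simps)
  show ?thesis unfolding b a y2 by Groebner_Basis.algebra
qed

lemma on_curve_ec_add:
  assumes "on_curve a b P" and "on_curve a b Q"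
  shows "on_curve a b (ec_add a P Q)"
proof (cases P)
  case (Affine x1 y1)
  note P = this
  show ?thesis
  proof (cases Q)
    case (Affine x2 y2)
    show ?thesis
    proof (cases "x1 = x2 \<and> y1 = - y2")
      case False
      with assms P Affine obtain m where "ec_slope a x1 y1 x2 y2 m"
        and *: "ec_add a P Q = Affine (m\<^sup>2 - x1 - x2) (m * (x1 - (m\<^sup>2 - x1 - x2)) - y1)"
        by (auto simp: on_curve_def elim: ec_slope_exists)
      with cubic_minus_line[of y1 x1 a b x2 y2 m "m\<^sup>2 - x1 - x2"] assms(1) P
      show ?thesis unfolding * by (simp add: on_curve_def power2_eq_square algebra_simps)
    qed (use P Affine in \<open>simp add: on_curve_def\<close>)
  qed (use P assms in simp)
qed (use assms in simp)

lemma ec_add_Infinity_right [simp]: "ec_add a P Infinity = P"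
  by (cases P) auto

lemma ec_add_commute:
  assumes "on_curve a b P" and "on_curve a b Q"
  shows "ec_add a P Q = ec_add a Q P"
proof (cases P; cases Q)
  fix x1 y1 x2 y2 assume PQ: "P = Affine x1 y1" "Q = Affine x2 y2"
  show ?thesis
  proof (cases "x1 = x2 \<and> y1 = - y2")
    case False
    with assms PQ obtain m where m: "ec_slope a x1 y1 x2 y2 m"
      and *: "ec_add a P Q = Affine (m\<^sup>2 - x1 - x2) (m * (x1 - (m\<^sup>2 - x1 - x2)) - y1)"
      by (auto simp: on_curve_def elim: ec_slope_exists)
    have "ec_add a Q P = Affine (m\<^sup>2 - x2 - x1) (m * (x2 - (m\<^sup>2 - x2 - x1)) - y2)"
      unfolding PQ by (rule ec_add_slope[OF ec_slope_sym[OF m]]) (use False in auto)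
    moreover have "y2 = y1 + m * (x2 - x1)" using m by (simp add: ec_slope_def algebra_simps)
    ultimately show ?thesis unfolding * by (simp add: algebra_simps)
  qed (use PQ in auto)
qed auto

lemma ec_add_neg [simp]: "ec_add a P (ec_neg P) = Infinity" "ec_add a (ec_neg P) P = Infinity"
  by (cases P; simp)+

lemma ec_neg_neg [simp]: "ec_neg (ec_neg P) = P"
  by (cases P) auto

lemma on_curve_ec_neg [simp]: "on_curve a b (ec_neg P) \<longleftrightarrow> on_curve a b P"
  by (cases P) (auto simp: on_curve_def)

text \<open>Nonsingularity enters the group law only here: it excludes \<open>Q + R = Q\<close> for affine \<open>R\<close>.\<close>

lemma ec_add_neg_cancel:
  assumes ns: "4 * a ^ 3 + 27 * b\<^sup>2 \<noteq> 0"
    and "on_curve a b Q" and "on_curve a b R"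
  shows "ec_add a (ec_neg Q) (ec_add a Q R) = R"
proof (cases Q; cases R)
  fix x1 y1 x2 y2 assume Q: "Q = Affine x1 y1" and R: "R = Affine x2 y2"
  have c: "y1\<^sup>2 = x1 ^ 3 + a * x1 + b" "y2\<^sup>2 = x2 ^ 3 + a * x2 + b"
    using assms Q R by (auto simp: on_curve_def)
  show ?thesis
  proof (cases "x1 = x2 \<and> y1 = - y2")
    case False
    with c obtain m where m: "ec_slope a x1 y1 x2 y2 m"
      and *: "ec_add a Q R = Affine (m\<^sup>2 - x1 - x2) (m * (x1 - (m\<^sup>2 - x1 - x2)) - y1)"
      unfolding Q R by (rule ec_slope_exists)
    define x y where x: "x = m\<^sup>2 - x1 - x2" and y: "y = m * (x1 - x) - y1"
    have m': "y2 - y1 = m * (x2 - x1)" "m * (y1 + y2) = x1\<^sup>2 + x1 * x2 + x2\<^sup>2 + a"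
      using m by (auto simp: ec_slope_def algebra_simps)
    have "ec_slope a x1 (- y1) x y (- m)"
      unfolding ec_slope_def x y using m' by Groebner_Basis.algebra
    moreover have "\<not> (x1 = x \<and> - y1 = - y)"
    proof
      assume "x1 = x \<and> - y1 = - y"
      hence "x = x1" "y = y1" by auto
      hence "2 * y1 = 0" "m\<^sup>2 = 2 * x1 + x2" using x y by (auto simp: algebra_simps)
      hence "y1 = 0" "m\<^sup>2 = 2 * x1 + x2" by auto
      with m' have "3 * x1\<^sup>2 + a = 0" by Groebner_Basis.algebra
      moreover have "x1 ^ 3 + a * x1 + b = 0" using c \<open>y1 = 0\<close> by simp
      ultimately have "4 * a ^ 3 + 27 * b\<^sup>2 = 0" by Groebner_Basis.algebra
      thus False using ns by simp
    qed
    ultimately have "ec_add a (ec_neg Q) (ec_add a Q R) =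
        Affine ((-m)\<^sup>2 - x1 - x) (- m * (x1 - ((-m)\<^sup>2 - x1 - x)) - (- y1))"
      unfolding * unfolding x[symmetric] y[symmetric] unfolding Q ec_neg.simps by (rule ec_add_slope)
    also have "(-m)\<^sup>2 - x1 - x = x2" by (simp add: x)
    also have "- m * (x1 - x2) - - y1 = y2" using m' by (simp add: algebra_simps)
    finally show ?thesis by (simp add: R)
  qed (simp add: Q R)
qed auto

text \<open>Here \<open>\<alpha>\<close> is the second divided difference of \<open>y\<close> at \<open>x1\<close>, \<open>x2\<close>, \<open>x3\<close>, that is, the leading coefficient of the
  parabola through the three points, and \<open>\<mu>\<close> is the slope in the addition of \<open>A = P + Q\<close> and \<open>R\<close>.
  Multiplicities need no separate treatment, except for \<open>A = R\<close>.\<close>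

lemma assoc_slope:
  fixes a :: "'a::field_char_0"
  assumes c1: "y1\<^sup>2 = x1 ^ 3 + a * x1 + b" 
    and m: "ec_slope a x1 y1 x2 y2 m" and k: "ec_slope a x2 y2 x3 y3 k"
    and xA: "xA = m\<^sup>2 - x1 - x2" and yA: "yA = m * (x1 - xA) - y1"
    and \<mu>: "ec_slope a xA yA x3 y3 \<mu>" and nA: "\<not> (xA = x3 \<and> yA = - y3)"
    and "x1 \<noteq> x3" and \<alpha>: "\<alpha> = (k - m) / (x3 - x1)"
  shows "\<alpha> * (\<mu> + m) = 1"
proof -
  have km: "k - m = \<alpha> * (x3 - x1)" using assms by simp
  have mm: "y2 - y1 = m * (x2 - x1)" "m * (y1 + y2) = x1\<^sup>2 + x1 * x2 + x2\<^sup>2 + a"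
    using m by (auto simp: ec_slope_def algebra_simps)
  have kk: "y3 - y2 = k * (x3 - x2)" "k * (y2 + y3) = x2\<^sup>2 + x2 * x3 + x3\<^sup>2 + a"
    using k by (auto simp: ec_slope_def algebra_simps)
  \<comment> \<open>\<open>y3\<close> plus the height over \<open>x3\<close> of the line through the first two points\<close>
  define w where "w = y3 + y1 + m * (x3 - x1)"
  have "(x3 - x1) * (x3 - xA) = (x3 - x1) * (\<alpha> * w)"
    unfolding w_def xA using mm kk km by Groebner_Basis.algebra
  hence w: "x3 - xA = \<alpha> * w" using \<open>x1 \<noteq> x3\<close> by simp
  have \<mu>': "y3 - yA = \<mu> * (x3 - xA)" "\<mu> * (yA + y3) = xA\<^sup>2 + xA * x3 + x3\<^sup>2 + a"
    using \<mu> by (auto simp: ec_slope_def)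
  have w2: "(\<mu> + m) * (x3 - xA) = w"
    using \<mu>'(1) yA w_def by Groebner_Basis.algebra
  show ?thesis
  proof (cases "w = 0")
    case False
    have "(\<alpha> * (\<mu> + m)) * w = 1 * w" using w w2 by Groebner_Basis.algebra
    thus ?thesis using False by simp
  next
    case True
    hence "xA = x3" using w by simp
    moreover have "y3 = yA" using w_def True yA \<open>xA = x3\<close> by Groebner_Basis.algebra
    ultimately have "y3 \<noteq> 0" using nA by auto
    have "3 * x3\<^sup>2 + a = 2 * (y1 + m * (x3 - x1)) * m + (x3 - x1) * (x3 - x2)"
      using mm xA \<open>xA = x3\<close> by Groebner_Basis.algebra
    hence "2 * y3 * (\<mu> + m) = (x3 - x1) * (x3 - x2)"
      using \<mu>'(2) \<open>xA = x3\<close> \<open>y3 = yA\<close> True w_def by Groebner_Basis.algebra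
    moreover have "2 * y3 = \<alpha> * (x3 - x1) * (x3 - x2)"
      using True w_def mm kk km by Groebner_Basis.algebra
    ultimately have "2 * y3 * (\<alpha> * (\<mu> + m)) = 2 * y3 * 1" by Groebner_Basis.algebra
    thus ?thesis using \<open>y3 \<noteq> 0\<close> by simp
  qed
qed

text \<open>Whenever two of the points involved are opposite, or \<open>R = \<plusminus>P\<close>, the claim follows from commutativity and
  cancellation. Otherwise \<open>assoc_slope\<close> applies to both bracketings with the same \<open>\<alpha>\<close>, so that \<open>\<mu> + m = \<nu> + k\<close>, and
  the coordinates of both sums agree.\<close>

lemma ec_add_assoc:
  assumes ns: "4 * a ^ 3 + 27 * b\<^sup>2 \<noteq> 0"
    and P: "on_curve a b P" and Q: "on_curve a b Q" and R: "on_curve a b R"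
  shows "ec_add a (ec_add a P Q) R = ec_add a P (ec_add a Q R)"
proof -
  note canc = ec_add_neg_cancel[OF ns]
  have canc2: "ec_add a (ec_add a U V) (ec_neg V) = U" if "on_curve a b U" "on_curve a b V" for U V
    using canc[OF that(2) that(1)] that on_curve_ec_add[OF that] 
    by (metis ec_add_commute on_curve_ec_neg)
  have canc3: "ec_add a V (ec_add a (ec_neg V) U) = U" if "on_curve a b U" "on_curve a b V" for U V
    using canc[of "ec_neg V" U] that by simp
  have canc4: "ec_add a V (ec_neg (ec_add a U V)) = ec_neg U"
    if "on_curve a b U" "on_curve a b V" for U V
    using canc2[of "ec_neg U" "ec_add a U V"] canc[of U V] that on_curve_ec_add[OF that] by simp
  consider "P = Infinity \<or> Q = Infinity \<or> R = Infinity" | "P = ec_neg Q" | "Q = ec_neg R"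
    | "R = P" | "R = ec_neg P" | "ec_add a P Q = ec_neg R" | "P = ec_neg (ec_add a Q R)"
    | x1 y1 x2 y2 x3 y3 where "P = Affine x1 y1" "Q = Affine x2 y2" "R = Affine x3 y3"
      "\<not> (x1 = x2 \<and> y1 = - y2)" "\<not> (x2 = x3 \<and> y2 = - y3)" "x1 \<noteq> x3"
      "ec_add a P Q \<noteq> ec_neg R" "P \<noteq> ec_neg (ec_add a Q R)"
  proof (cases P; cases Q; cases R)
    fix x1 y1 x2 y2 x3 y3 assume aff: "P = Affine x1 y1" "Q = Affine x2 y2" "R = Affine x3 y3"
    have "y3 = y1 \<or> y3 = - y1" if "x1 = x3"
    proof -
      have "y3\<^sup>2 = y1\<^sup>2" using P R aff that by (simp add: on_curve_def)
      thus ?thesis by (simp add: power2_eq_iff)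
    qed
    hence "R = P \<or> R = ec_neg P" if "x1 = x3" using aff that by auto
    thus thesis using that aff by auto
  qed (use that in auto)
  thus ?thesis
  proof cases
    case 1
    thus ?thesis by auto
  next
    case 2
    thus ?thesis using canc[OF Q R] by simp
  next
    case 3
    thus ?thesis using canc2[of P "ec_neg R"] P Q R by simp
  next
    case 4
    thus ?thesis using ec_add_commute[OF P Q] ec_add_commute[OF P on_curve_ec_add[OF Q P]]
      by simp
  next
    case 5
    have "ec_add a Q (ec_neg P) = ec_add a (ec_neg P) Q"
      using P Q by (intro ec_add_commute) auto
    thus ?thesis using 5 canc3[OF Q P] canc2[OF Q P] ec_add_commute[OF P Q] by simp
  next
    case 6
    hence "R = ec_neg (ec_add a P Q)" by simp
    thus ?thesis using canc4[OF P Q] by simp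
  next
    case 7
    have "ec_add a R Q = ec_add a Q R" by (rule ec_add_commute[OF R Q])
    hence "ec_add a Q P = ec_neg R" using 7 canc4[OF R Q] by simp
    hence "ec_add a P Q = ec_neg R" using ec_add_commute[OF P Q] by simp
    thus ?thesis using 7 by simp
  next
    case (8 x1 y1 x2 y2 x3 y3)
    have c: "y1\<^sup>2 = x1 ^ 3 + a * x1 + b" "y2\<^sup>2 = x2 ^ 3 + a * x2 + b" "y3\<^sup>2 = x3 ^ 3 + a * x3 + b"
      using P Q R 8 by (auto simp: on_curve_def)
    from ec_slope_exists[OF c(1,2) 8(4)] obtain m where m: "ec_slope a x1 y1 x2 y2 m"
      and A': "ec_add a P Q = Affine (m\<^sup>2 - x1 - x2) (m * (x1 - (m\<^sup>2 - x1 - x2)) - y1)"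
      unfolding 8 by metis
    from ec_slope_exists[OF c(2,3) 8(5)] obtain k where k: "ec_slope a x2 y2 x3 y3 k"
      and B': "ec_add a Q R = Affine (k\<^sup>2 - x2 - x3) (k * (x2 - (k\<^sup>2 - x2 - x3)) - y2)"
      unfolding 8 by metis
    define xA yA xB yB where defs: "xA = m\<^sup>2 - x1 - x2" "yA = m * (x1 - xA) - y1"
      "xB = k\<^sup>2 - x2 - x3" "yB = k * (x2 - xB) - y2"
    have A: "ec_add a P Q = Affine xA yA" and B: "ec_add a Q R = Affine xB yB"
      unfolding A' B' defs by simp_all
    have mm: "y2 - y1 = m * (x2 - x1)" and kk: "y3 - y2 = k * (x3 - x2)"
      using m k by (auto simp: ec_slope_def)
    have yB: "yB = k * (x3 - xB) - y3" using kk by (simp add: defs algebra_simps)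
    have nA: "\<not> (xA = x3 \<and> yA = - y3)" and nB: "\<not> (x1 = xB \<and> y1 = - yB)"
      using 8 A B by auto
    have cA: "yA\<^sup>2 = xA ^ 3 + a * xA + b" and cB: "yB\<^sup>2 = xB ^ 3 + a * xB + b"
      using on_curve_ec_add[OF P Q] on_curve_ec_add[OF Q R] A B by (auto simp: on_curve_def)
    from ec_slope_exists[OF cA c(3) nA] obtain \<mu> where \<mu>: "ec_slope a xA yA x3 y3 \<mu>"
      and L: "ec_add a (ec_add a P Q) R = Affine (\<mu>\<^sup>2 - xA - x3) (\<mu> * (xA - (\<mu>\<^sup>2 - xA - x3)) - yA)"
      unfolding A unfolding 8 by metis
    from ec_slope_exists[OF c(1) cB nB] obtain \<nu> where \<nu>: "ec_slope a x1 y1 xB yB \<nu>"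
      and M: "ec_add a P (ec_add a Q R) = Affine (\<nu>\<^sup>2 - x1 - xB) (\<nu> * (x1 - (\<nu>\<^sup>2 - x1 - xB)) - y1)"
      unfolding B unfolding 8 by metis
    define \<alpha> where "\<alpha> = (k - m) / (x3 - x1)"
    have km: "k - m = \<alpha> * (x3 - x1)" using 8 by (simp add: \<alpha>_def)
    have 1: "\<alpha> * (\<mu> + m) = 1"
      by (rule assoc_slope[OF c(1) m k defs(1,2) \<mu> nA 8(6) \<alpha>_def])
    have 2: "\<alpha> * (\<nu> + k) = 1"
    proof (rule assoc_slope[OF c(3) ec_slope_sym[OF k] ec_slope_sym[OF m] _ yB ec_slope_sym[OF \<nu>]])
      show "xB = k\<^sup>2 - x3 - x2" by (simp add: defs)
      show "\<alpha> = (m - k) / (x1 - x3)" using 8(6) by (simp add: \<alpha>_def field_simps)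
    qed (use nB 8(6) in auto)
    have "\<alpha> \<noteq> 0" using 1 by auto
    have "\<alpha> * (\<mu> + m) = \<alpha> * (\<nu> + k)" using 1 2 by simp
    hence \<mu>\<nu>: "\<mu> + m = \<nu> + k" using \<open>\<alpha> \<noteq> 0\<close> by simp
    have "\<alpha> * (\<mu>\<^sup>2 - xA - x3) = \<alpha> * (\<nu>\<^sup>2 - x1 - xB)"
      unfolding defs using 1 2 \<mu>\<nu> km by Groebner_Basis.algebra
    hence X: "\<mu>\<^sup>2 - xA - x3 = \<nu>\<^sup>2 - x1 - xB" using \<open>\<alpha> \<noteq> 0\<close> by simp
    define z where z: "z = \<nu>\<^sup>2 - x1 - xB"
    have "\<alpha> * (\<alpha> * (x2 - z)) = \<alpha> * (m - \<nu>)"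
      unfolding z defs using 2 km by Groebner_Basis.algebra
    hence z2: "\<alpha> * (x2 - z) = m - \<nu>" using \<open>\<alpha> \<noteq> 0\<close> by simp
    have "y3 - yA = \<mu> * (x3 - xA)" using \<mu> by (simp add: ec_slope_def)
    hence Y: "\<mu> * (xA - z) - yA = \<nu> * (x1 - z) - y1"
      using \<mu>\<nu> km mm kk z2 by Groebner_Basis.algebra
    show ?thesis unfolding L M X z[symmetric] Y ..
  qed
qed

section \<open>Points over a subfield\<close>

lemma ring_of_type_algebra_simps [simp]:
  "carrier ring_of_type_algebra = UNIV" "monoid.mult ring_of_type_algebra = (*)"
  "one ring_of_type_algebra = 1" "zero ring_of_type_algebra = 0" "add ring_of_type_algebra = (+)"
  by (simp_all add: ring_of_type_algebra_def fun_eq_iff)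

lemma a_inv_ring_of_type_algebra [simp]:
  "\<ominus>\<^bsub>ring_of_type_algebra\<^esub> (x :: 'a::field) = - x"
proof -
  interpret cring "ring_of_type_algebra :: 'a ring" by (rule cring_from_type_algebra)
  show ?thesis using minus_equality[of "- x" x] by simp
qed

lemma m_inv_ring_of_type_algebra:
  "x \<noteq> 0 \<Longrightarrow> inv\<^bsub>ring_of_type_algebra\<^esub> (x :: 'a::field) = inverse x"
proof -
  assume "x \<noteq> 0"
  interpret cring "ring_of_type_algebra :: 'a ring" by (rule cring_from_type_algebra)
  show ?thesis using \<open>x \<noteq> 0\<close> by (intro comm_inv_char) auto
qed

lemma subfield_type_algebraI:
  fixes F :: "'a::field set"
  assumes "1 \<in> F" "\<And>x. x \<in> F \<Longrightarrow> - x \<in> F" "\<And>x y. x \<in> F \<Longrightarrow> y \<in> F \<Longrightarrow> x + y \<in> F"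
    "\<And>x y. x \<in> F \<Longrightarrow> y \<in> F \<Longrightarrow> x * y \<in> F" "\<And>x. x \<in> F \<Longrightarrow> x \<noteq> 0 \<Longrightarrow> inverse x \<in> F"
  shows "subfield F ring_of_type_algebra"
proof -
  interpret field "ring_of_type_algebra :: 'a ring" by (rule field_from_type_algebra)
  show ?thesis
    by (intro subfieldI' subringI) (use assms in \<open>auto simp: m_inv_ring_of_type_algebra\<close>)
qed

lemma subfield_type_algebraD:
  fixes F :: "'a::field set"
  assumes "subfield F ring_of_type_algebra"
  shows "0 \<in> F" "1 \<in> F" "x \<in> F \<Longrightarrow> - x \<in> F" "x \<in> F \<Longrightarrow> y \<in> F \<Longrightarrow> x + y \<in> F"
    "x \<in> F \<Longrightarrow> y \<in> F \<Longrightarrow> x * y \<in> F" "x \<in> F \<Longrightarrow> y \<in> F \<Longrightarrow> x - y \<in> F"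
    "x \<in> F \<Longrightarrow> y \<in> F \<Longrightarrow> x / y \<in> F" "x \<in> F \<Longrightarrow> x ^ k \<in> F" "numeral w \<in> F"
proof -
  interpret field "ring_of_type_algebra :: 'a ring" by (rule field_from_type_algebra)
  note E = subringE[OF subfieldE(1)[OF assms], simplified]
  show neg: "x \<in> F \<Longrightarrow> - x \<in> F" and add: "x \<in> F \<Longrightarrow> y \<in> F \<Longrightarrow> x + y \<in> F" for x y
    using E by auto
  show mult: "x \<in> F \<Longrightarrow> y \<in> F \<Longrightarrow> x * y \<in> F" for x y using E by auto
  show "0 \<in> F" "1 \<in> F" using E by auto
  show "x \<in> F \<Longrightarrow> y \<in> F \<Longrightarrow> x - y \<in> F" using add[of x "- y"] neg[of y] by simp
  have "inverse y \<in> F" if "y \<in> F"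
    using subfield_m_inv(1)[OF assms, of y] that \<open>0 \<in> F\<close>
    by (cases "y = 0") (auto simp: m_inv_ring_of_type_algebra)
  thus "x \<in> F \<Longrightarrow> y \<in> F \<Longrightarrow> x / y \<in> F" using mult[of x "inverse y"] by (simp add: divide_inverse)
  show "x \<in> F \<Longrightarrow> x ^ k \<in> F" by (induction k) (auto intro: mult \<open>1 \<in> F\<close>)
  have "of_nat n \<in> F" for n by (induction n) (auto intro: add \<open>1 \<in> F\<close> \<open>0 \<in> F\<close>)
  from this[of "numeral w"] show "numeral w \<in> F" by simp
qed

lemma subfield_Rats: "subfield \<rat> real_ring"
  by (rule subfield_type_algebraI) auto

lemma ec_add_closed:
  fixes F :: "'a::field_char_0 set"
  assumes F: "subfield F ring_of_type_algebra" and "a \<in> F"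
    and "set_ec_point P \<subseteq> F" and "set_ec_point Q \<subseteq> F"
  shows "set_ec_point (ec_add a P Q) \<subseteq> F"
  using assms(2-) by (cases P; cases Q) (auto simp: Let_def intro!: subfield_type_algebraD[OF F])

lemma set_ec_neg:
  fixes F :: "'a::field_char_0 set"
  assumes F: "subfield F ring_of_type_algebra" and "set_ec_point P \<subseteq> F"
  shows "set_ec_point (ec_neg P) \<subseteq> F"
  using assms(2-) by (cases P) (auto intro!: subfield_type_algebraD[OF F])

lemma comm_group_ec_group:
  fixes F :: "'a::field_char_0 set"
  assumes F: "subfield F ring_of_type_algebra" and "a \<in> F" and ns: "4 * a ^ 3 + 27 * b\<^sup>2 \<noteq> 0"
  shows "comm_group (ec_group a b F)"
proof (rule comm_groupI)
  fix P assume "P \<in> carrier (ec_group a b F)"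
  hence "ec_neg P \<in> carrier (ec_group a b F)"
    using set_ec_neg[OF F, of P] by (auto simp: ec_group_def)
  thus "\<exists>Q\<in>carrier (ec_group a b F). Q \<otimes>\<^bsub>ec_group a b F\<^esub> P = \<one>\<^bsub>ec_group a b F\<^esub>"
    by (intro bexI[of _ "ec_neg P"]) (auto simp: ec_group_def)
qed (use ec_add_closed[OF F \<open>a \<in> F\<close>] on_curve_ec_add ec_add_commute ec_add_assoc[OF ns]
      in \<open>auto simp: ec_group_def on_curve_def\<close>)

text \<open>No compatibility with negation or division has to be assumed: a ring homomorphism on \<open>F\<close> respects both and is
  injective, so it respects the case distinctions in the addition of points.\<close>

lemma map_ec_point_hom:
  fixes F :: "'a::field_char_0 set"
  assumes F: "subfield F ring_of_type_algebra" and "a \<in> F" "b \<in> F"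
    and clo: "\<And>x. x \<in> F \<Longrightarrow> s x \<in> F"
    and add: "\<And>x y. x \<in> F \<Longrightarrow> y \<in> F \<Longrightarrow> s (x + y) = s x + s y"
    and mult: "\<And>x y. x \<in> F \<Longrightarrow> y \<in> F \<Longrightarrow> s (x * y) = s x * s y"
    and one: "s 1 = 1" and "s a = a" "s b = b"
  shows "map_ec_point s \<in> hom (ec_group a b F) (ec_group a b F)"
proof -
  note F' = subfield_type_algebraD[OF F]
  have zero: "s 0 = 0" using add[of 0 0] F' by simp
  have neg: "s (- x) = - s x" if "x \<in> F" for x
    using add[of x "- x"] F' that zero by (simp add: add_eq_0_iff2 add_eq_0_iff)
  have diff: "s (x - y) = s x - s y" if "x \<in> F" "y \<in> F" for x y
    using add[of x "- y"] neg[of y] F' that by simp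
  have inj: "s x = s y \<longleftrightarrow> x = y" if "x \<in> F" "y \<in> F" for x y
  proof
    assume *: "s x = s y"
    show "x = y"
    proof (rule ccontr)
      assume "x \<noteq> y"
      hence "s ((x - y) * (1 / (x - y))) = 1" using one by simp
      moreover have "s ((x - y) * (1 / (x - y))) = s (x - y) * s (1 / (x - y))"
        using F' that by (intro mult) auto
      ultimately show False using diff[OF that] * by simp
    qed
  qed simp
  have div: "s (x / y) = s x / s y" if "x \<in> F" "y \<in> F" for x y
  proof (cases "y = 0")
    case False
    hence "s y \<noteq> 0" using inj[of y 0] zero that F' by simp
    have "s x = s (x / y * y)" using False by simp
    also have "\<dots> = s (x / y) * s y" using F' that by (intro mult) auto
    finally show ?thesis using \<open>s y \<noteq> 0\<close> by simp
  qed (simp add: zero)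
  have pow: "s (x ^ k) = s x ^ k" if "x \<in> F" for x k
    using that by (induction k) (auto simp: one mult F')
  have two: "s 2 = 2" and three: "s 3 = 3"
    using add[of 1 1] add[of 2 1] F' one by auto
  note s = zero one neg add mult diff div pow two three
  have curve: "on_curve a b (map_ec_point s P)" if "on_curve a b P" "set_ec_point P \<subseteq> F" for P
  proof (cases P)
    case (Affine x y)
    with that have "s (y\<^sup>2) = s (x ^ 3 + a * x + b)" and "x \<in> F" "y \<in> F"
      by (auto simp: on_curve_def)
    thus ?thesis using Affine assms s by (simp add: on_curve_def F')
  qed (simp add: on_curve_def)
  show ?thesis
  proof (rule homI)
    fix P assume "P \<in> carrier (ec_group a b F)"
    thus "map_ec_point s P \<in> carrier (ec_group a b F)"
      using curve[of P] clo by (cases P) (auto simp: ec_group_def)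
  next
    fix P Q assume PQ: "P \<in> carrier (ec_group a b F)" "Q \<in> carrier (ec_group a b F)"
    show "map_ec_point s (P \<otimes>\<^bsub>ec_group a b F\<^esub> Q) =
      map_ec_point s P \<otimes>\<^bsub>ec_group a b F\<^esub> map_ec_point s Q"
    proof (cases P; cases Q)
      fix x1 y1 x2 y2 assume 1: "P = Affine x1 y1" "Q = Affine x2 y2"
      hence 2: "x1 \<in> F" "y1 \<in> F" "x2 \<in> F" "y2 \<in> F" using PQ by (auto simp: ec_group_def)
      have "s y1 = - s y2 \<longleftrightarrow> y1 = - y2" using inj[of y1 "- y2"] neg 2 F' by simp
      thus ?thesis using 1 2 \<open>a \<in> F\<close> \<open>s a = a\<close> s by (simp add: ec_group_def Let_def inj F')
    qed (auto simp: ec_group_def)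
  qed
qed

text \<open>The homomorphism property of the 2-descent map \<open>P \<mapsto> x(P) - e\<close>: evaluate the cubic minus the square of the line
  at its root \<open>e\<close>.\<close>

lemma ec_add_root_square:
  fixes F :: "'a::field_char_0 set"
  assumes F: "subfield F ring_of_type_algebra"
    and "on_curve a b (Affine x1 y1)" "on_curve a b (Affine x2 y2)"
    and "ec_add a (Affine x1 y1) (Affine x2 y2) = Affine x y"
    and "{x1, y1, x2, y2, a, e} \<subseteq> F" and e: "e ^ 3 + a * e + b = 0"
  shows "\<exists>u\<in>F. (x1 - e) * (x2 - e) * (x - e) = u\<^sup>2"
proof -
  have n: "\<not> (x1 = x2 \<and> y1 = - y2)" using assms(4) by auto
  have c: "y1\<^sup>2 = x1 ^ 3 + a * x1 + b" "y2\<^sup>2 = x2 ^ 3 + a * x2 + b"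
    using assms by (auto simp: on_curve_def)
  obtain m where m: "ec_slope a x1 y1 x2 y2 m"
    and *: "ec_add a (Affine x1 y1) (Affine x2 y2) =
      Affine (m\<^sup>2 - x1 - x2) (m * (x1 - (m\<^sup>2 - x1 - x2)) - y1)"
    and m': "m = (if x1 = x2 then (3 * x1\<^sup>2 + a) / (2 * y1) else (y2 - y1) / (x2 - x1))"
    using ec_slope_exists[OF c n] by metis
  have "m \<in> F" unfolding m' using assms(5) by (auto intro!: subfield_type_algebraD[OF F])
  hence "y1 + m * (e - x1) \<in> F" using assms(5) by (auto intro!: subfield_type_algebraD[OF F])
  moreover have "(x1 - e) * (x2 - e) * (x - e) = (y1 + m * (e - x1))\<^sup>2"
  proof -
    have "x = m\<^sup>2 - x1 - x2" using assms(4) * by simp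
    thus ?thesis using cubic_minus_line[OF c(1) m, of e] unfolding e by Groebner_Basis.algebra
  qed
  ultimately show ?thesis by blast
qed

section \<open>Independence and rank in abelian groups\<close>

lemma int_linear_dependence:
  fixes f :: "'b \<Rightarrow> 'a \<Rightarrow> int"
  assumes "finite A" "finite S" "card A < card S"
  shows "\<exists>c. (\<exists>s\<in>S. c s \<noteq> 0) \<and> (\<forall>a\<in>A. (\<Sum>s\<in>S. c s * f s a) = 0)"
  using assms
proof (induction A arbitrary: S f rule: finite_induct)
  case empty
  hence "S \<noteq> {}" by auto
  thus ?case by (intro exI[of _ "\<lambda>_. 1"]) auto
next
  case (insert a A)
  show ?case
  proof (cases "\<exists>s0\<in>S. f s0 a \<noteq> 0")
    case False
    obtain c where "\<exists>s\<in>S. c s \<noteq> 0" "\<forall>a\<in>A. (\<Sum>s\<in>S. c s * f s a) = 0"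
      using insert.IH[of S f] insert.prems insert.hyps by auto
    thus ?thesis using False by (intro exI[of _ c]) auto
  next
    case True
    then obtain s0 where s0: "s0 \<in> S" "f s0 a \<noteq> 0" by blast
    define g where "g s x = f s0 a * f s x - f s a * f s0 x" for s x
    have "card A < card (S - {s0})" using insert.prems insert.hyps s0 by simp
    then obtain c where c: "\<exists>s\<in>S - {s0}. c s \<noteq> 0" "\<And>x. x \<in> A \<Longrightarrow> (\<Sum>s\<in>S - {s0}. c s * g s x) = 0"
      using insert.IH[of "S - {s0}" g] insert.prems by auto
    define d where "d s = (if s = s0 then - (\<Sum>s\<in>S - {s0}. c s * f s a) else f s0 a * c s)" for s
    have sum: "(\<Sum>s\<in>S. d s * f s x) = (\<Sum>s\<in>S - {s0}. c s * g s x)" for x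
    proof -
      have "(\<Sum>s\<in>S. d s * f s x) = d s0 * f s0 x + (\<Sum>s\<in>S - {s0}. d s * f s x)"
        using s0 insert.prems by (simp add: sum.remove)
      also have "(\<Sum>s\<in>S - {s0}. d s * f s x) = (\<Sum>s\<in>S - {s0}. f s0 a * c s * f s x)"
        by (intro sum.cong) (auto simp: d_def)
      finally show ?thesis
        by (simp add: d_def g_def sum_distrib_right sum_distrib_left algebra_simps sum_subtractf)
    qed
    have "(\<Sum>s\<in>S - {s0}. c s * g s a) = 0" by (simp add: g_def)
    moreover have "\<exists>s\<in>S. d s \<noteq> 0" using c(1) s0 by (auto simp: d_def)
    ultimately show ?thesis using c(2) by (intro exI[of _ d]) (auto simp: sum)
  qed
qed

lemma hom_finprod_comm_group:
  assumes "comm_group G" "comm_group H" "h \<in> hom G H" "f \<in> S \<rightarrow> carrier G"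
  shows "h (finprod G f S) = finprod H (\<lambda>x. h (f x)) S"
proof -
  interpret G: comm_group G by fact
  interpret H: comm_group H by fact
  have one: "h \<one>\<^bsub>G\<^esub> = \<one>\<^bsub>H\<^esub>" by (rule hom_one[OF assms(3) G.is_group H.is_group])
  show ?thesis
  proof (cases "finite S")
    case True
    thus ?thesis using assms(4)
    proof (induction S rule: finite_induct)
      case (insert x S)
      have "(\<lambda>x. h (f x)) \<in> insert x S \<rightarrow> carrier H"
        using insert.prems hom_in_carrier[OF assms(3)] by auto
      thus ?case using insert by (simp add: hom_mult[OF assms(3)] Pi_iff)
    qed (simp add: one)
  qed (simp add: one)
qed

lemma int_independent_incl:
  assumes "comm_group G" "comm_group H" "(\<lambda>x. x) \<in> hom G H" "S \<subseteq> carrier G"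
  shows "int_independent G S \<longleftrightarrow> int_independent H S"
proof -
  interpret G: comm_group G by fact
  interpret H: comm_group H by fact
  have "finprod G (\<lambda>a. a [^]\<^bsub>G\<^esub> c a) S = finprod H (\<lambda>a. a [^]\<^bsub>H\<^esub> c a) S" for c :: "_ \<Rightarrow> int"
  proof -
    have pow: "a [^]\<^bsub>G\<^esub> c a = a [^]\<^bsub>H\<^esub> c a" if "a \<in> S" for a
      using hom_int_pow[OF assms(3) _ G.is_group H.is_group, of a "c a"] that assms(4) by auto
    have "finprod G (\<lambda>a. a [^]\<^bsub>G\<^esub> c a) S = finprod H (\<lambda>a. a [^]\<^bsub>G\<^esub> c a) S"
      using assms(4) by (intro hom_finprod_comm_group[OF assms(1-3)]) auto
    also have "\<dots> = finprod H (\<lambda>a. a [^]\<^bsub>H\<^esub> c a) S"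
      using assms(4) hom_in_carrier[OF assms(3)] pow
      by (intro H.finprod_cong') auto
    finally show ?thesis .
  qed
  moreover have "\<one>\<^bsub>G\<^esub> = \<one>\<^bsub>H\<^esub>" using hom_one[OF assms(3) G.is_group H.is_group] .
  moreover have "S \<subseteq> carrier H" using assms(4) hom_in_carrier[OF assms(3)] by auto
  ultimately show ?thesis using assms(4) by (simp add: int_independent_def)
qed

context comm_group
begin

lemma finprod_int_pow:
  assumes "finite A" "f \<in> A \<rightarrow> carrier G"
  shows "finprod G f A [^] (k::int) = finprod G (\<lambda>a. f a [^] k) A"
  using assms by (induction A rule: finite_induct) (auto simp: int_pow_distrib Pi_iff)

lemma generate_finprod:
  assumes "finite A" "A \<subseteq> carrier G" "x \<in> generate G A"
  shows "\<exists>c :: 'a \<Rightarrow> int. x = (\<Otimes>a\<in>A. a [^] c a)"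
  using assms(3)
proof (induction rule: generate.induct)
  case one
  show ?case by (intro exI[of _ "\<lambda>_. 0"]) simp
next
  case (incl h)
  have "(\<Otimes>a\<in>A. a [^] (if a = h then 1 else 0 :: int)) = (\<Otimes>a\<in>A. if h = a then a else \<one>)"
    using assms(2) by (intro finprod_cong') auto
  also have "\<dots> = h" using finprod_singleton[OF incl assms(1), of "\<lambda>x. x"] assms(2) by auto
  finally show ?case by metis
next
  case (inv h)
  have "(\<Otimes>a\<in>A. a [^] (if a = h then - 1 else 0 :: int)) = (\<Otimes>a\<in>A. if h = a then inv a else \<one>)"
    using assms(2) by (intro finprod_cong') (auto simp: int_pow_neg)
  also have "\<dots> = inv h" using finprod_singleton[OF inv assms(1), of "\<lambda>x. inv x"] assms(2) by auto
  finally show ?case by metis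
next
  case (eng h1 h2)
  then obtain c d :: "'a \<Rightarrow> int"
    where "h1 = (\<Otimes>a\<in>A. a [^] c a)" "h2 = (\<Otimes>a\<in>A. a [^] d a)" by blast
  moreover have "(\<Otimes>a\<in>A. a [^] (c a + d a)) = (\<Otimes>a\<in>A. a [^] c a \<otimes> a [^] d a)"
    using assms(2) by (intro finprod_cong') (auto simp: int_pow_mult)
  ultimately have "h1 \<otimes> h2 = (\<Otimes>a\<in>A. a [^] (c a + d a))"
    using assms(2) by (subst (asm) finprod_multf) auto
  thus ?case by (intro exI[of _ "\<lambda>a. c a + d a"])
qed

text \<open>Independent elements of the span of \<open>A\<close> are at most as many as the elements of \<open>A\<close>.\<close>

lemma int_independent_card_le:
  assumes "finite A" "A \<subseteq> carrier G" "S \<subseteq> generate G A" "int_independent G S"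
  shows "card S \<le> card A"
proof (rule ccontr)
  assume "\<not> card S \<le> card A"
  have S: "finite S" "S \<subseteq> carrier G" using assms(4) by (auto simp: int_independent_def)
  have "\<forall>s\<in>S. \<exists>c :: 'a \<Rightarrow> int. s = (\<Otimes>a\<in>A. a [^] c a)"
    using generate_finprod[OF assms(1,2)] assms(3) by blast
  then obtain f :: "'a \<Rightarrow> 'a \<Rightarrow> int" where f: "\<And>s. s \<in> S \<Longrightarrow> s = (\<Otimes>a\<in>A. a [^] f s a)"
    by metis
  obtain c where c: "\<exists>s\<in>S. c s \<noteq> 0" "\<And>a. a \<in> A \<Longrightarrow> (\<Sum>s\<in>S. c s * f s a) = 0"
    using int_linear_dependence[OF assms(1) S(1), of f] \<open>\<not> card S \<le> card A\<close> by auto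
  have exchange: "(\<Otimes>s\<in>T. s [^] c s) = (\<Otimes>a\<in>A. a [^] (\<Sum>s\<in>T. c s * f s a))" if "T \<subseteq> S" for T
    using finite_subset[OF that S(1)] that
  proof (induction T rule: finite_induct)
    case (insert s T)
    have "s [^] c s = (\<Otimes>a\<in>A. a [^] f s a) [^] c s" using f[of s] insert.prems by simp
    also have "\<dots> = (\<Otimes>a\<in>A. (a [^] f s a) [^] c s)"
      using assms(2) by (intro finprod_int_pow[OF assms(1)]) auto
    also have "\<dots> = (\<Otimes>a\<in>A. a [^] (c s * f s a))"
      using assms(2) by (intro finprod_cong') (auto simp: int_pow_pow mult.commute)
    finally have s: "s [^] c s = (\<Otimes>a\<in>A. a [^] (c s * f s a))" .
    have "(\<Otimes>s\<in>insert s T. s [^] c s) = s [^] c s \<otimes> (\<Otimes>s\<in>T. s [^] c s)"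
      using insert S(2) by (intro finprod_insert) auto
    also have "\<dots> = (\<Otimes>a\<in>A. a [^] (c s * f s a) \<otimes> a [^] (\<Sum>s\<in>T. c s * f s a))"
      using insert assms(2) by (subst finprod_multf) (auto simp: s)
    also have "\<dots> = (\<Otimes>a\<in>A. a [^] (\<Sum>s\<in>insert s T. c s * f s a))"
      using insert assms(2) by (intro finprod_cong') (auto simp: int_pow_mult)
    finally show ?case .
  qed simp
  have "(\<Otimes>s\<in>S. s [^] c s) = (\<Otimes>a\<in>A. a [^] (\<Sum>s\<in>S. c s * f s a))" by (rule exchange) simp
  also have "\<dots> = \<one>" by (intro finprod_one_eqI) (simp add: c)
  finally show False using assms(4) c(1) by (auto simp: int_independent_def)
qed

end

lemma ab_rank_eqI:
  assumes "int_independent G S" "\<And>T. int_independent G T \<Longrightarrow> card T \<le> card S"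
  shows "ab_rank G = enat (card S)"
  unfolding ab_rank_def using assms by (intro antisym SUP_least SUP_upper) auto

lemma ab_rank_geI:
  assumes "\<And>S. int_independent G S \<Longrightarrow> \<exists>T. int_independent H T \<and> card T = card S + k"
  shows "ab_rank G + enat k \<le> ab_rank H"
proof (cases "ab_rank H")
  case (enat r)
  have le: "card S + k \<le> r" if S: "int_independent G S" for S
  proof -
    obtain T where "int_independent H T" "card T = card S + k" using assms[OF S] by blast
    hence "enat (card S + k) \<le> ab_rank H" unfolding ab_rank_def by (metis SUP_upper mem_Collect_eq)
    thus ?thesis using enat by simp
  qed
  have "int_independent G {}" by (simp add: int_independent_def)
  hence "k \<le> r" using le[of "{}"] by simp
  have "ab_rank G \<le> enat (r - k)"
    unfolding ab_rank_def using le by (intro SUP_least) (auto simp: le_diff_conv2 \<open>k \<le> r\<close>)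
  hence "ab_rank G + enat k \<le> enat (r - k) + enat k" by (rule add_right_mono)
  thus ?thesis using enat \<open>k \<le> r\<close> by simp
qed simp

section \<open>Abelian groups with an automorphism of order three\<close>

text \<open>An abelian group, written multiplicatively, with an endomorphism \<open>s\<close> such that \<open>s\<^sup>3 = 1\<close>; in other words a module
  over the group ring of the cyclic group of order three.\<close>

locale order_three_action = comm_group G for G (structure) +
  fixes s
  assumes s_hom: "s \<in> hom G G" and s_cubed: "x \<in> carrier G \<Longrightarrow> s (s (s x)) = x"
begin

text \<open>The element \<open>a + b s + c s\<^sup>2\<close> of the group ring applied to \<open>x\<close>; thus \<open>orb x 1 1 1\<close> is the trace of \<open>x\<close> and
  \<open>orb x 1 (- 1) 0\<close> the quotient of \<open>x\<close> by \<open>s x\<close>.\<close>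

definition orb :: "'a \<Rightarrow> int \<Rightarrow> int \<Rightarrow> int \<Rightarrow> 'a" where
  "orb x a b c = x [^] a \<otimes> s x [^] b \<otimes> s (s x) [^] c"

lemma s_closed [simp]: "x \<in> carrier G \<Longrightarrow> s x \<in> carrier G"
  by (rule hom_in_carrier[OF s_hom])

lemma orb_closed [simp]: "x \<in> carrier G \<Longrightarrow> orb x a b c \<in> carrier G"
  by (simp add: orb_def)

lemma orb_mult:
  "x \<in> carrier G \<Longrightarrow> orb x a b c \<otimes> orb x a' b' c' = orb x (a + a') (b + b') (c + c')"
  by (simp add: orb_def int_pow_mult m_ac)

lemma orb_pow: "x \<in> carrier G \<Longrightarrow> orb x a b c [^] k = orb x (k * a) (k * b) (k * c)"
  by (simp add: orb_def int_pow_distrib int_pow_pow mult.commute)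

lemma s_orb: "x \<in> carrier G \<Longrightarrow> s (orb x a b c) = orb x c a b"
  by (simp add: orb_def hom_mult[OF s_hom] hom_int_pow[OF s_hom _ is_group is_group] s_cubed m_ac)

lemma s_one: "s \<one> = \<one>"
  by (rule hom_one[OF s_hom is_group is_group])

lemma orb_one: "x \<in> carrier G \<Longrightarrow> orb x 1 0 0 = x" "x \<in> carrier G \<Longrightarrow> orb x 0 1 0 = s x"
  by (simp_all add: orb_def)

lemma orb_trace_diff: "x \<in> carrier G \<Longrightarrow> orb (orb x 1 (- 1) 0) 1 1 1 = \<one>"
  by (simp add: orb_def[of "orb _ _ _ _"] s_orb orb_mult) (simp add: orb_def)

text \<open>On an element of trace one, \<open>s\<close> acts as a primitive cube root of unity \<open>\<omega>\<close>. Multiplying \<open>a + b \<omega>\<close> by the conjugate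
  \<open>(a - b) - b \<omega>\<close> gives the norm \<open>a\<^sup>2 - a b + b\<^sup>2\<close>, which is positive unless \<open>a = b = 0\<close>.\<close>

lemma eisenstein_independent:
  assumes x: "x \<in> carrier G" and tr: "orb x 1 1 1 = \<one>"
    and inf: "\<And>k :: int. x [^] k = \<one> \<Longrightarrow> k = 0" and ab: "orb x a b 0 = \<one>"
  shows "a = 0 \<and> b = 0"
proof -
  have "orb x 0 a b = \<one>" using s_orb[OF x, of a b 0] ab by (simp add: s_one)
  moreover have "orb x (- b) (- b) (- b) = \<one>" using orb_pow[OF x, of 1 1 1 "- b"] tr by simp
  ultimately have "orb x (- b) (a - b) 0 = \<one>" using orb_mult[OF x, of 0 a b "- b" "- b" "- b"] by simp
  hence "orb x (b * b) (- b * (a - b)) 0 = \<one>" using orb_pow[OF x, of "- b" "a - b" 0 "- b"] by simp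
  moreover have "orb x ((a - b) * a) ((a - b) * b) 0 = \<one>"
    using orb_pow[OF x, of a b 0 "a - b"] ab by simp
  ultimately have "orb x ((a - b) * a + b * b) 0 0 = \<one>"
    using orb_mult[OF x, of "(a - b) * a" "(a - b) * b" 0 "b * b" "- b * (a - b)" 0]
    by (simp add: mult.commute)
  hence "x [^] ((a - b) * a + b * b) = \<one>" using x by (simp add: orb_def)
  hence *: "(a - b) * a + b * b = 0" by (rule inf)
  have "(2 * a - b)\<^sup>2 + 3 * b\<^sup>2 = 4 * ((a - b) * a + b * b)"
    by (simp add: power2_eq_square algebra_simps)
  hence "(2 * a - b)\<^sup>2 + 3 * b\<^sup>2 = 0" using * by simp
  hence "b = 0 \<and> 2 * a - b = 0"
    by (metis add_nonneg_eq_0_iff mult_eq_0_iff zero_le_power2 zero_neq_numeral zero_le_mult_iff zero_le_numeral power_eq_0_iff)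
  thus ?thesis by simp
qed

lemma orbit_independent_trace_one:
  assumes x: "x \<in> carrier G" and tr: "orb x 1 1 1 = \<one>"
    and inf: "\<And>k :: int. x [^] k = \<one> \<Longrightarrow> k = 0"
  shows "x \<noteq> s x" "int_independent G {x, s x}"
proof -
  show ne: "x \<noteq> s x"
  proof
    assume "x = s x"
    hence "orb x 1 (- 1) 0 = \<one>" using x by (simp add: orb_def int_pow_neg)
    thus False using eisenstein_independent[OF x tr inf] by fastforce
  qed
  show "int_independent G {x, s x}"
    unfolding int_independent_def
  proof (intro conjI allI impI)
    fix c :: "'a \<Rightarrow> int" assume "(\<Otimes>a\<in>{x, s x}. a [^] c a) = \<one>"
    hence "orb x (c x) (c (s x)) 0 = \<one>" using x ne by (simp add: orb_def)
    thus "\<forall>a\<in>{x, s x}. c a = 0" using eisenstein_independent[OF x tr inf] by auto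
  qed (use x in auto)
qed

text \<open>Taking the trace of a relation \<open>a + b s + c s\<^sup>2\<close> gives \<open>a + b + c = 0\<close>; the relation is then one between the
  differences \<open>d\<close> and \<open>s d\<close>.\<close>

lemma orbit_independent:
  assumes x: "x \<in> carrier G"
    and inf: "\<And>k :: int. orb x 1 1 1 [^] k = \<one> \<Longrightarrow> k = 0"
    and inf': "\<And>k :: int. orb x 1 (- 1) 0 [^] k = \<one> \<Longrightarrow> k = 0"
  shows "card {x, s x, s (s x)} = 3" "int_independent G {x, s x, s (s x)}"
proof -
  define d where "d = orb x 1 (- 1) 0"
  have d: "d \<in> carrier G" "orb d 1 1 1 = \<one>"
    using x by (simp_all add: d_def orb_trace_diff)
  have indep: "a = 0 \<and> b = 0 \<and> c = 0" if 1: "orb x a b c = \<one>" for a b c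
  proof -
    have 2: "orb x c a b = \<one>" using s_orb[OF x, of a b c] 1 by (simp add: s_one)
    have 3: "orb x b c a = \<one>" using s_orb[OF x, of c a b] 2 by (simp add: s_one)
    have "orb x (a + c + b) (b + a + c) (c + b + a) = orb x a b c \<otimes> orb x c a b \<otimes> orb x b c a"
      using x by (simp add: orb_mult)
    also have "\<dots> = \<one>" by (simp add: 1 2 3)
    finally have "orb x 1 1 1 [^] (a + b + c) = \<one>"
      using orb_pow[OF x, of 1 1 1 "a + b + c"] by (simp add: ac_simps)
    hence "a + b + c = 0" by (rule inf)
    hence c: "c = - a - b" by simp
    have "orb d a (a + b) 0 = \<one>"
      using x 1 by (simp add: d_def orb_def[of "orb _ _ _ _"] s_orb orb_pow orb_mult c)
    hence "a = 0 \<and> a + b = 0"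
      using inf' by (intro eisenstein_independent[OF d]) (auto simp: d_def)
    thus ?thesis using c by simp
  qed
  have ne: "x \<noteq> s x" "s x \<noteq> s (s x)" "x \<noteq> s (s x)"
    using indep[of 1 "- 1" 0] indep[of 0 1 "- 1"] indep[of 1 0 "- 1"] x
    by (auto simp: orb_def int_pow_neg)
  thus "card {x, s x, s (s x)} = 3" by auto
  show "int_independent G {x, s x, s (s x)}"
    unfolding int_independent_def
  proof (intro conjI allI impI)
    fix c :: "'a \<Rightarrow> int" assume "(\<Otimes>a\<in>{x, s x, s (s x)}. a [^] c a) = \<one>"
    hence "orb x (c x) (c (s x)) (c (s (s x))) = \<one>" using x ne by (simp add: orb_def m_assoc)
    thus "\<forall>a\<in>{x, s x, s (s x)}. c a = 0" using indep by auto
  qed (use x in auto)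
qed

text \<open>In a relation between \<open>d\<close>, \<open>s d\<close> and fixed elements, the part \<open>w\<close> in \<open>d\<close> and \<open>s d\<close> is fixed and of trace one,
  so \<open>w\<^sup>3 = 1\<close>.\<close>

lemma fixed_independent_extend:
  assumes d: "d \<in> carrier G" and tr: "orb d 1 1 1 = \<one>"
    and inf: "\<And>k :: int. d [^] k = \<one> \<Longrightarrow> k = 0"
    and S: "int_independent G S" and fixed: "\<And>a. a \<in> S \<Longrightarrow> s a = a"
  shows "\<exists>T. int_independent G T \<and> card T = card S + 2"
proof (intro exI conjI)
  have fin: "finite S" and SG: "S \<subseteq> carrier G" using S by (auto simp: int_independent_def)
  have ne: "d \<noteq> s d" by (rule orbit_independent_trace_one(1)[OF d tr inf])
  have ne2: "s d \<noteq> s (s d)" using ne s_cubed[OF d] by metis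
  have notin: "d \<notin> S" "s d \<notin> S" using fixed ne ne2 by metis+
  show "card (insert d (insert (s d) S)) = card S + 2" using ne notin fin by simp
  show "int_independent G (insert d (insert (s d) S))"
    unfolding int_independent_def
  proof (intro conjI allI impI)
    fix c :: "'a \<Rightarrow> int" assume *: "(\<Otimes>a\<in>insert d (insert (s d) S). a [^] c a) = \<one>"
    define z where "z = (\<Otimes>a\<in>S. a [^] c a)"
    define w where "w = orb d (c d) (c (s d)) 0"
    have z: "z \<in> carrier G" unfolding z_def using SG by (intro finprod_closed) auto
    have w: "w \<in> carrier G" unfolding w_def using d by simp
    have zw: "w \<otimes> z = \<one>"
      using * fin ne notin d SG z by (simp add: z_def w_def orb_def subset_iff m_assoc)
    have "s z = (\<Otimes>a\<in>S. s (a [^] c a))"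
      unfolding z_def using SG by (intro hom_finprod_comm_group[OF _ _ s_hom]) (auto intro: comm_group_axioms)
    also have "\<dots> = z" unfolding z_def using SG fixed
      by (intro finprod_cong') (auto simp: hom_int_pow[OF s_hom _ is_group is_group] subset_iff)
    finally have sz: "s z = z" .
    have w': "w = inv z" using zw z w by (metis inv_equality)
    interpret s: group_hom G G s by unfold_locales (rule s_hom)
    have "s w = w" using sz z w' by simp
    hence "orb d 0 (c d) (c (s d)) = w" "orb d (c (s d)) 0 (c d) = w"
      using s_orb[OF d, of "c d" "c (s d)" 0] s_orb[OF d, of 0 "c d" "c (s d)"] by (simp_all add: w_def)
    hence "w \<otimes> w \<otimes> w = orb d (c d) (c (s d)) 0 \<otimes> orb d 0 (c d) (c (s d)) \<otimes> orb d (c (s d)) 0 (c d)"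
      by (simp add: w_def)
    also have "\<dots> = orb d 1 1 1 [^] (c d + c (s d))"
      using d by (simp add: orb_mult orb_pow ac_simps)
    finally have "w \<otimes> w \<otimes> w = \<one>" by (simp add: tr)
    moreover have "w \<otimes> w \<otimes> w = orb d (3 * c d) (3 * c (s d)) 0"
      using d by (simp add: w_def orb_mult)
    ultimately have "3 * c d = 0 \<and> 3 * c (s d) = 0"
      by (intro eisenstein_independent[OF d tr inf]) auto
    hence c0: "c d = 0" "c (s d) = 0" by auto
    hence "z = \<one>" using zw z d by (simp add: w_def orb_def)
    hence "\<forall>a\<in>S. c a = 0" using S by (simp add: int_independent_def z_def)
    thus "\<forall>a\<in>insert d (insert (s d) S). c a = 0" using c0 by auto
  qed (use d fin SG in auto)
qed

end

section \<open>Simplest cubic fields and the valuation at 2\<close>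

text \<open>The element with coordinates \<open>a\<close>, \<open>b\<close>, \<open>c\<close> with respect to \<open>1\<close>, \<open>r\<close>, \<open>r\<^sup>2\<close>.\<close>

definition quad :: "real \<Rightarrow> real \<Rightarrow> real \<Rightarrow> real \<Rightarrow> real" where
  "quad r a b c = a + b * r + c * r\<^sup>2"

abbreviation quad_int :: "real \<Rightarrow> int \<Rightarrow> int \<Rightarrow> int \<Rightarrow> real" where
  "quad_int r a b c \<equiv> quad r (of_int a) (of_int b) (of_int c)"

text \<open>The action of the Galois group on the roots of \<open>g\<^sub>t\<close>.\<close>

definition conj_root :: "real \<Rightarrow> real" where
  "conj_root r = - 1 / (r + 1)"

text \<open>The norm of \<open>a + b r + c r\<^sup>2\<close>, for a root \<open>r\<close> of \<open>g\<^sub>t\<close>.\<close>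

definition norm_form :: "int \<Rightarrow> int \<Rightarrow> int \<Rightarrow> int \<Rightarrow> int" where
  "norm_form t a b c =
     a ^ 3 + t * a\<^sup>2 * b + (t\<^sup>2 + 2 * t + 6) * a\<^sup>2 * c - (t + 3) * a * b\<^sup>2 - (t\<^sup>2 + 3 * t + 3) * a * b * c
     + (t\<^sup>2 + 4 * t + 9) * a * c\<^sup>2 + b ^ 3 + t * b\<^sup>2 * c - (t + 3) * b * c\<^sup>2 + c ^ 3"

text \<open>This is the inertness of 2: an integral element that is nonzero modulo 2 has odd norm.\<close>

lemma odd_norm_form: "odd a \<or> odd b \<or> odd c \<Longrightarrow> odd (norm_form t a b c)"
  unfolding norm_form_def by (cases "even t"; cases "even a"; cases "even b"; cases "even c") simp_all

lemma int_triple_primitive: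
  fixes a b c :: int
  assumes "a \<noteq> 0 \<or> b \<noteq> 0 \<or> c \<noteq> 0"
  shows "\<exists>k a' b' c'. a = 2 ^ k * a' \<and> b = 2 ^ k * b' \<and> c = 2 ^ k * c' \<and> (odd a' \<or> odd b' \<or> odd c')"
  using assms
proof (induction "nat (\<bar>a\<bar> + \<bar>b\<bar> + \<bar>c\<bar>)" arbitrary: a b c rule: less_induct)
  case less
  show ?case
  proof (cases "odd a \<or> odd b \<or> odd c")
    case True
    thus ?thesis by (intro exI[of _ 0] exI[of _ a] exI[of _ b] exI[of _ c]) auto
  next
    case False
    then obtain a1 b1 c1 where 1: "a = 2 * a1" "b = 2 * b1" "c = 2 * c1" by (auto elim!: evenE)
    have "nat (\<bar>a1\<bar> + \<bar>b1\<bar> + \<bar>c1\<bar>) < nat (\<bar>a\<bar> + \<bar>b\<bar> + \<bar>c\<bar>)"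
      using less.prems 1 by linarith
    moreover have "a1 \<noteq> 0 \<or> b1 \<noteq> 0 \<or> c1 \<noteq> 0" using less.prems 1 by simp
    ultimately obtain k a' b' c' where "a1 = 2 ^ k * a'" "b1 = 2 ^ k * b'" "c1 = 2 ^ k * c'"
      and odd: "odd a' \<or> odd b' \<or> odd c'"
      using less.hyps[of a1 b1 c1] by blast
    hence "a = 2 ^ Suc k * a'" "b = 2 ^ Suc k * b'" "c = 2 ^ Suc k * c'" using 1 by simp_all
    thus ?thesis using odd by blast
  qed
qed

text \<open>The field generated by an arbitrary real root \<open>r\<close> of \<open>g\<^sub>t\<close>. All results apply to the conjugate roots as well,
  because \<open>conj_root r\<close> satisfies the same assumption.\<close>

locale simplest_cubic =
  fixes t :: int and r :: real
  assumes root: "r ^ 3 - of_int t * r\<^sup>2 - (of_int t + 3) * r - 1 = 0"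
begin

text \<open>The span of \<open>1\<close>, \<open>r\<close>, \<open>r\<^sup>2\<close> over the rationals; it is a field, see \<open>generate_field_eq_K\<close> below.\<close>

definition K :: "real set" where
  "K = {quad r a b c | a b c. a \<in> \<rat> \<and> b \<in> \<rat> \<and> c \<in> \<rat>}"

lemma r_plus_1: "r + 1 \<noteq> 0"
proof
  assume "r + 1 = 0"
  hence "r = - 1" by simp
  thus False using root by simp
qed

lemma conj_root_eq: "conj_root r = r\<^sup>2 - (of_int t + 1) * r - 2"
proof -
  have "(r\<^sup>2 - (of_int t + 1) * r - 2) * (r + 1) = - 1"
    using root by Groebner_Basis.algebra
  thus ?thesis using r_plus_1 by (simp add: conj_root_def field_simps)
qed

lemma conj_root_conj: "simplest_cubic t (conj_root r)"
  unfolding simplest_cubic_def conj_root_eq using root by Groebner_Basis.algebra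

lemma conj_root_conj_root_eq: "conj_root (conj_root r) = of_int t - r - conj_root r"
  unfolding simplest_cubic.conj_root_eq[OF conj_root_conj] unfolding conj_root_eq
  using root by Groebner_Basis.algebra

lemma factorization:
  "x ^ 3 - of_int t * x\<^sup>2 - (of_int t + 3) * x - 1
   = (x - r) * (x - conj_root r) * (x - conj_root (conj_root r))"
  unfolding conj_root_conj_root_eq unfolding conj_root_eq using root by Groebner_Basis.algebra

lemma quad_conj: "quad (conj_root r) a b c =
  quad r (a - 2 * b + (2 - of_int t) * c) (- (of_int t + 1) * b - ((of_int t)\<^sup>2 + of_int t + 1) * c)
    (b + of_int t * c)"
proof -
  have sq: "(conj_root r)\<^sup>2 = of_int t * r\<^sup>2 - ((of_int t)\<^sup>2 + of_int t + 1) * r + (2 - of_int t)"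
    unfolding conj_root_eq using root by Groebner_Basis.algebra
  show ?thesis unfolding quad_def sq unfolding conj_root_eq by (simp add: algebra_simps)
qed

text \<open>Reduction of the product with the help of \<open>r\<^sup>3 = t r\<^sup>2 + (t + 3) r + 1\<close> and
  \<open>r\<^sup>4 = (t\<^sup>2 + t + 3) r\<^sup>2 + (t\<^sup>2 + 3 t + 1) r + t\<close>.\<close>

lemma quad_mult:
  fixes a b c a' b' c' :: real
  defines "p3 \<equiv> b * c' + c * b'" and "p4 \<equiv> c * c'"
  shows "quad r a b c * quad r a' b' c' =
    quad r (a * a' + p3 + of_int t * p4)
      (a * b' + b * a' + (of_int t + 3) * p3 + ((of_int t)\<^sup>2 + 3 * of_int t + 1) * p4)
      (a * c' + b * b' + c * a' + of_int t * p3 + ((of_int t)\<^sup>2 + of_int t + 3) * p4)"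
  unfolding quad_def p3_def p4_def using root by Groebner_Basis.algebra

text \<open>The second part says that the integral elements modulo 2 have no zero divisors.\<close>

lemma quad_int_mult:
  "\<exists>a'' b'' c''. quad_int r a b c * quad_int r a' b' c' = quad_int r a'' b'' c'' \<and>
    (odd a \<or> odd b \<or> odd c \<longrightarrow> odd a' \<or> odd b' \<or> odd c' \<longrightarrow> odd a'' \<or> odd b'' \<or> odd c'')"
proof (intro exI conjI impI)
  let ?p3 = "b * c' + c * b'" and ?p4 = "c * c'"
  let ?a = "a * a' + ?p3 + t * ?p4"
    and ?b = "a * b' + b * a' + (t + 3) * ?p3 + (t\<^sup>2 + 3 * t + 1) * ?p4"
    and ?c = "a * c' + b * b' + c * a' + t * ?p3 + (t\<^sup>2 + t + 3) * ?p4"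
  show "quad_int r a b c * quad_int r a' b' c' = quad_int r ?a ?b ?c"
    unfolding quad_mult by simp
  assume "odd a \<or> odd b \<or> odd c" "odd a' \<or> odd b' \<or> odd c'"
  thus "odd ?a \<or> odd ?b \<or> odd ?c"
    by (cases "even t"; cases "even a"; cases "even b"; cases "even c"; cases "even a'"; cases "even b'";
        cases "even c'") simp_all
qed

lemma quad_norm:
  "quad_int r a b c * quad_int (conj_root r) a b c * quad_int (conj_root (conj_root r)) a b c
   = of_int (norm_form t a b c)"
proof -
  define u v where uv: "u = conj_root r" "v = conj_root u"
  have e1: "r + u + v = of_int t" using conj_root_conj_root_eq by (simp add: uv)
  have e3: "r * u * v = 1" using factorization[of 0] by (simp add: uv)
  have "(- 1 - r) * (- 1 - u) * (- 1 - v) = 1" using factorization[of "-1"] by (simp add: uv)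
  hence e2: "r * u + r * v + u * v = - (of_int t + 3)" using e1 e3 by Groebner_Basis.algebra
  have "(a + b * r + c * r\<^sup>2) * (a + b * u + c * u\<^sup>2) * (a + b * v + c * v\<^sup>2) =
      a ^ 3 + (r + u + v) * a\<^sup>2 * b + ((r + u + v)\<^sup>2 - 2 * (r * u + r * v + u * v)) * a\<^sup>2 * c
      + (r * u + r * v + u * v) * a * b\<^sup>2
      + ((r + u + v) * (r * u + r * v + u * v) - 3 * (r * u * v)) * a * b * c
      + ((r * u + r * v + u * v)\<^sup>2 - 2 * (r + u + v) * (r * u * v)) * a * c\<^sup>2
      + (r * u * v) * b ^ 3 + (r + u + v) * (r * u * v) * b\<^sup>2 * c
      + (r * u + r * v + u * v) * (r * u * v) * b * c\<^sup>2 + (r * u * v)\<^sup>2 * c ^ 3" for a b c :: real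
    by Groebner_Basis.algebra
  from this[of "of_int a" "of_int b" "of_int c"] show ?thesis
    unfolding e1 e2 e3 quad_def norm_form_def uv[symmetric]
    by (simp add: power2_eq_square algebra_simps)
qed

lemma quad_int_adjugate:
  "\<exists>a' b' c'. quad_int r a b c * quad_int r a' b' c' = of_int (norm_form t a b c)"
proof -
  have conj: "\<exists>a' b' c'. quad_int (conj_root r) a b c = quad_int r a' b' c'" for a b c
    unfolding quad_conj
    by (intro exI[of _ "a - 2 * b + (2 - t) * c"] exI[of _ "- (t + 1) * b - (t\<^sup>2 + t + 1) * c"]
        exI[of _ "b + t * c"]) simp
  interpret c: simplest_cubic t "conj_root r" by (rule conj_root_conj)
  have conj': "\<exists>a' b' c'. quad_int (conj_root (conj_root r)) a b c = quad_int (conj_root r) a' b' c'"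
    unfolding c.quad_conj
    by (intro exI[of _ "a - 2 * b + (2 - t) * c"] exI[of _ "- (t + 1) * b - (t\<^sup>2 + t + 1) * c"]
        exI[of _ "b + t * c"]) simp
  from conj conj' quad_int_mult quad_norm[of a b c] show ?thesis by (metis mult.assoc)
qed

lemma quad_int_nonzero:
  assumes "odd a \<or> odd b \<or> odd c"
  shows "quad_int r a b c \<noteq> 0"
proof
  assume "quad_int r a b c = 0"
  hence "norm_form t a b c = 0" using quad_norm[of a b c] by simp
  thus False using odd_norm_form[OF assms, of t] by simp
qed

lemma quad_int_eq_0: "quad_int r a b c = 0 \<longleftrightarrow> a = 0 \<and> b = 0 \<and> c = 0"
proof
  assume *: "quad_int r a b c = 0"
  show "a = 0 \<and> b = 0 \<and> c = 0"
  proof (rule ccontr)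
    assume "\<not> (a = 0 \<and> b = 0 \<and> c = 0)"
    then obtain k a' b' c' where k: "a = 2 ^ k * a'" "b = 2 ^ k * b'" "c = 2 ^ k * c'"
      and odd: "odd a' \<or> odd b' \<or> odd c'" using int_triple_primitive[of a b c] by blast
    have "quad_int r a b c = 2 ^ k * quad_int r a' b' c'" by (simp add: k quad_def algebra_simps)
    thus False using * quad_int_nonzero[OF odd] by simp
  qed
qed (simp add: quad_def)

lemma Rats_triple_common_denominator:
  assumes "a \<in> \<rat>" "b \<in> \<rat>" "c \<in> \<rat>"
  obtains d a' b' c' :: int where "d \<noteq> 0" "(a::real) = of_int a' / of_int d" "(b::real) = of_int b' / of_int d"
    "(c::real) = of_int c' / of_int d"
proof -
  from assms obtain a1 d1 b1 d2 c1 d3 :: int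
    where "d1 \<noteq> 0" "d2 \<noteq> 0" "d3 \<noteq> 0" "a = of_int a1 / of_int d1" "b = of_int b1 / of_int d2"
      "c = of_int c1 / of_int d3"
    unfolding Rats_eq_int_div_int by auto
  thus thesis by (intro that[of "d1 * d2 * d3" "a1 * d2 * d3" "b1 * d1 * d3" "c1 * d1 * d2"]) auto
qed

lemma quad_Rats_eq_0:
  assumes "a \<in> \<rat>" "b \<in> \<rat>" "c \<in> \<rat>" "quad r a b c = 0"
  shows "a = 0 \<and> b = 0 \<and> c = 0"
proof -
  obtain d a' b' c' :: int where d: "d \<noteq> 0" "a = of_int a' / of_int d" "b = of_int b' / of_int d"
    "c = of_int c' / of_int d" using Rats_triple_common_denominator[OF assms(1-3)] .
  have "quad_int r a' b' c' = quad r a b c * of_int d"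
    unfolding d(2-4) using d(1) by (simp add: quad_def field_simps)
  thus ?thesis using assms(4) quad_int_eq_0[of a' b' c'] d by simp
qed

lemma quad_Rats_inject:
  assumes "a \<in> \<rat>" "b \<in> \<rat>" "c \<in> \<rat>" "a' \<in> \<rat>" "b' \<in> \<rat>" "c' \<in> \<rat>" "quad r a b c = quad r a' b' c'"
  shows "a = a' \<and> b = b' \<and> c = c'"
proof -
  have "quad r (a - a') (b - b') (c - c') = 0" using assms(7) by (simp add: quad_def algebra_simps)
  thus ?thesis using quad_Rats_eq_0[of "a - a'" "b - b'" "c - c'"] assms by auto
qed

text \<open>The graph of the 2-adic valuation: \<open>V k x\<close> says that \<open>x = 2\<^sup>k u\<close> where \<open>u\<close> has coordinates with odd denominators in
  the basis \<open>1\<close>, \<open>r\<close>, \<open>r\<^sup>2\<close>, not all divisible by 2. A relation is used because zero has no valuation.\<close>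

definition V :: "int \<Rightarrow> real \<Rightarrow> bool" where
  "V k x \<longleftrightarrow> (\<exists>d a b c. odd d \<and> (odd a \<or> odd b \<or> odd c) \<and>
     x * of_int d = 2 powi k * quad_int r a b c)"

lemma V_nonzero: "V k x \<Longrightarrow> x \<noteq> 0"
  using quad_int_nonzero by (fastforce simp: V_def)

lemma VI:
  assumes "odd d" "odd a \<or> odd b \<or> odd c" "x * of_int d = 2 powi k * quad_int r a b c"
  shows "V k x"
  using assms by (auto simp: V_def)

lemma V_quad:
  assumes "a \<noteq> 0 \<or> b \<noteq> 0 \<or> c \<noteq> 0" "d \<noteq> 0" "x * of_int d = quad_int r a b c"
  shows "\<exists>k. V k x"
proof -
  obtain i a' b' c' where i: "a = 2 ^ i * a'" "b = 2 ^ i * b'" "c = 2 ^ i * c'"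
    and odd: "odd a' \<or> odd b' \<or> odd c'" using int_triple_primitive[OF assms(1)] by blast
  obtain j d' where d: "d = 2 ^ j * d'" "odd d'"
    using int_triple_primitive[of d 0 0] assms(2) by auto
  have "x * (2 ^ j * of_int d') = 2 ^ i * quad_int r a' b' c'"
    using assms(3) by (simp add: i d quad_def algebra_simps)
  hence "x * of_int d' = 2 powi (int i - int j) * quad_int r a' b' c'"
    by (simp add: power_int_diff field_simps)
  thus ?thesis using VI[OF d(2) odd] by blast
qed

lemma V_exists:
  assumes "x \<in> K" "x \<noteq> 0"
  shows "\<exists>k. V k x"
proof -
  obtain a b c where x: "x = quad r a b c" "a \<in> \<rat>" "b \<in> \<rat>" "c \<in> \<rat>" using assms by (auto simp: K_def)
  obtain d a' b' c' :: int where d: "d \<noteq> 0" "a = of_int a' / of_int d" "b = of_int b' / of_int d"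
    "c = of_int c' / of_int d" using Rats_triple_common_denominator[OF x(2-4)] .
  have "x * of_int d = quad_int r a' b' c'"
    unfolding x(1) d(2-4) using d(1) by (simp add: quad_def field_simps)
  moreover have "a' \<noteq> 0 \<or> b' \<noteq> 0 \<or> c' \<noteq> 0" using assms(2) d x by (auto simp: quad_def)
  ultimately show ?thesis using V_quad d(1) by blast
qed

lemma V_mult:
  assumes "V k x" "V l y"
  shows "V (k + l) (x * y)"
proof -
  from assms obtain d a b c d' a' b' c' where
    1: "odd d" "odd a \<or> odd b \<or> odd c" "x * of_int d = 2 powi k * quad_int r a b c" and
    2: "odd d'" "odd a' \<or> odd b' \<or> odd c'" "y * of_int d' = 2 powi l * quad_int r a' b' c'"
    unfolding V_def by metis
  obtain a'' b'' c'' where 3: "quad_int r a b c * quad_int r a' b' c' = quad_int r a'' b'' c''"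
    and 4: "odd a'' \<or> odd b'' \<or> odd c''" using quad_int_mult[of a b c a' b' c'] 1(2) 2(2) by auto
  have "x * y * of_int (d * d') = (x * of_int d) * (y * of_int d')" by simp
  also have "\<dots> = 2 powi (k + l) * quad_int r a'' b'' c''"
    unfolding 1 2 by (simp add: 3[symmetric] power_int_add)
  finally show ?thesis using VI[of "d * d'"] 1(1) 2(1) 4 by simp
qed

lemma V_unique:
  assumes "V k x" "V l x"
  shows "k = l"
proof -
  have False if "V k x" "V l x" "k < l" for k l
  proof -
    from that obtain d a b c d' a' b' c' where
      1: "odd d" "odd a \<or> odd b \<or> odd c" "x * of_int d = 2 powi k * quad_int r a b c" and
      2: "odd d'" "odd a' \<or> odd b' \<or> odd c'" "x * of_int d' = 2 powi l * quad_int r a' b' c'"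
      unfolding V_def by metis
    define j where "j = nat (l - k)"
    have l: "l = k + int j" and "j > 0" using that(3) by (simp_all add: j_def)
    have "2 powi k * (quad_int r a b c * of_int d') = x * of_int d * of_int d'" using 1 by simp
    also have "\<dots> = 2 powi k * (2 ^ j * quad_int r a' b' c' * of_int d)"
      using 2(3) by (simp add: l power_int_add algebra_simps)
    finally have "quad_int r a b c * of_int d' = 2 ^ j * quad_int r a' b' c' * of_int d" by simp
    hence "quad_int r (a * d' - 2 ^ j * a' * d) (b * d' - 2 ^ j * b' * d) (c * d' - 2 ^ j * c' * d) = 0"
      by (simp add: quad_def algebra_simps)
    hence "a * d' = 2 ^ j * a' * d" "b * d' = 2 ^ j * b' * d" "c * d' = 2 ^ j * c' * d"
      unfolding quad_int_eq_0 by auto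
    hence "even (a * d')" "even (b * d')" "even (c * d')" using \<open>j > 0\<close> by simp_all
    thus False using 1(2) 2(1) by simp
  qed
  thus ?thesis using assms by (metis linorder_neqE)
qed

lemma V_add:
  assumes "V k x" "V l y" "k < l"
  shows "V k (x + y)"
proof -
  from assms obtain d a b c d' a' b' c' where
    1: "odd d" "odd a \<or> odd b \<or> odd c" "x * of_int d = 2 powi k * quad_int r a b c" and
    2: "odd d'" "odd a' \<or> odd b' \<or> odd c'" "y * of_int d' = 2 powi l * quad_int r a' b' c'"
    unfolding V_def by metis
  define j where "j = nat (l - k)"
  have l: "l = k + int j" and "j > 0" using assms(3) by (simp_all add: j_def)
  have "(x + y) * of_int (d * d') = (x * of_int d) * of_int d' + (y * of_int d') * of_int d"
    by (simp add: algebra_simps)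
  also have "\<dots> = 2 powi k * quad_int r (a * d' + 2 ^ j * a' * d) (b * d' + 2 ^ j * b' * d) (c * d' + 2 ^ j * c' * d)"
    unfolding 1 2 by (simp add: l power_int_add quad_def algebra_simps)
  finally show ?thesis by (rule VI[rotated 2]) (use 1(1,2) 2(1) \<open>j > 0\<close> in auto)
qed

lemma V_odd: "odd m \<Longrightarrow> V 0 (of_int m)"
  by (rule VI[of 1 m 0 0]) (auto simp: quad_def)

lemma V_1: "V 0 1" and V_minus_1: "V 0 (- 1)" and V_2: "V 1 2"
  using V_odd[of 1] V_odd[of "-1"] VI[of 1 1 0 0 2 1] by (simp_all add: quad_def)

lemma V_power2: "V k x \<Longrightarrow> V (2 * k) (x\<^sup>2)"
  using V_mult[of k x k x] by (simp add: power2_eq_square)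

lemma V_inverse:
  assumes "V k x"
  shows "V (- k) (inverse x)"
proof -
  from assms obtain d a b c where
    1: "odd d" "odd a \<or> odd b \<or> odd c" "x * of_int d = 2 powi k * quad_int r a b c"
    unfolding V_def by metis
  obtain a' b' c' where adj: "quad_int r a b c * quad_int r a' b' c' = of_int (norm_form t a b c)"
    using quad_int_adjugate by blast
  have N: "odd (norm_form t a b c)" by (rule odd_norm_form[OF 1(2)])
  have ne: "quad_int r a b c \<noteq> 0" "x \<noteq> 0" using quad_int_nonzero[OF 1(2)] V_nonzero[OF assms] by auto
  have nz: "a' \<noteq> 0 \<or> b' \<noteq> 0 \<or> c' \<noteq> 0" using adj N by (auto simp: quad_def)
  have "inverse (quad_int r a b c) * of_int (norm_form t a b c) = quad_int r a' b' c'"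
    using ne by (simp add: adj[symmetric])
  then obtain l where l: "V l (inverse (quad_int r a b c))"
    using V_quad[OF nz, of "norm_form t a b c"] N by fastforce
  have "V 0 (quad_int r a b c)" by (rule VI[of 1 a b c]) (use 1(2) in auto)
  from V_mult[OF this l] have "V l 1" using ne by simp
  hence "l = 0" using V_unique V_1 by blast
  have "V 0 (of_int d)" using V_odd[OF 1(1)] .
  moreover have "V (- k) (2 powi (- k))" by (rule VI[of 1 1 0 0]) (simp_all add: quad_def)
  ultimately have "V (0 + (- k) + 0) (of_int d * 2 powi (- k) * inverse (quad_int r a b c))"
    using l \<open>l = 0\<close> V_mult by blast
  also have "of_int d * 2 powi (- k) * inverse (quad_int r a b c) = inverse x"
    using 1(3) ne by (simp add: power_int_minus field_simps)
  finally show ?thesis by simp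
qed

lemma V_divide: "V k x \<Longrightarrow> V l y \<Longrightarrow> V (k - l) (x / y)"
  using V_mult[OF _ V_inverse] by (fastforce simp: divide_inverse)

lemma K_D: "quad r a b c \<in> K" if "a \<in> \<rat>" "b \<in> \<rat>" "c \<in> \<rat>"
  using that by (auto simp: K_def)

lemma Rats_subset_K: "\<rat> \<subseteq> K"
  using K_D[of _ 0 0] by (auto simp: quad_def)

lemma subfield_K: "subfield K real_ring"
proof (rule subfield_type_algebraI)
  show "1 \<in> K" using Rats_subset_K by auto
next
  fix x assume "x \<in> K"
  then obtain a b c where x: "x = quad r a b c" "a \<in> \<rat>" "b \<in> \<rat>" "c \<in> \<rat>" by (auto simp: K_def)
  hence "- x = quad r (- a) (- b) (- c)" by (simp add: quad_def)
  thus "- x \<in> K" using K_D[of "- a" "- b" "- c"] x by simp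
next
  fix x y assume "x \<in> K" "y \<in> K"
  then obtain a b c a' b' c' where x: "x = quad r a b c" "a \<in> \<rat>" "b \<in> \<rat>" "c \<in> \<rat>"
    and y: "y = quad r a' b' c'" "a' \<in> \<rat>" "b' \<in> \<rat>" "c' \<in> \<rat>" by (auto simp: K_def)
  hence "x + y = quad r (a + a') (b + b') (c + c')" by (simp add: quad_def algebra_simps)
  thus "x + y \<in> K" using K_D[of "a + a'" "b + b'" "c + c'"] x y by simp
  show "x * y \<in> K" unfolding x(1) y(1) quad_mult using x y by (intro K_D) auto
next
  fix x assume "x \<in> K" "x \<noteq> 0"
  then obtain k where "V k x" using V_exists by blast
  then obtain d a b c where
    1: "odd d" "odd a \<or> odd b \<or> odd c" "inverse x * of_int d = 2 powi (- k) * quad_int r a b c"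
    using V_inverse unfolding V_def by metis
  have "d \<noteq> 0" using 1(1) by auto
  hence "inverse x = 2 powi (- k) * quad_int r a b c / of_int d"
    using 1(3) by (simp only: eq_divide_eq) simp
  hence "inverse x = quad r (2 powi (- k) * of_int a / of_int d) (2 powi (- k) * of_int b / of_int d)
     (2 powi (- k) * of_int c / of_int d)"
    by (simp add: quad_def add_divide_distrib algebra_simps)
  moreover have "(2::real) powi (- k) \<in> \<rat>" by (auto simp: power_int_def)
  ultimately show "inverse x \<in> K" by (simp add: K_D)
qed

lemma r_in_K: "r \<in> K"
  using K_D[of 0 1 0] by (auto simp: quad_def)

lemma generate_field_eq_K: "generate_field real_ring {r} = K"
proof
  interpret field real_ring by (rule field_from_type_algebra)
  show "generate_field real_ring {r} \<subseteq> K"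
    using generate_field_min_subfield1[of "{r}" K] subfield_K r_in_K by simp
  have sf: "subfield (generate_field real_ring {r}) real_ring"
    by (rule generate_field_is_subfield) simp
  have r: "r \<in> generate_field real_ring {r}" by (intro generate_field.incl) simp
  note F = subfield_type_algebraD[OF sf]
  have int: "of_int m \<in> generate_field real_ring {r}" for m
  proof -
    have "of_nat n \<in> generate_field real_ring {r}" for n by (induction n) (auto intro: F)
    thus ?thesis by (cases m rule: int_cases2) (auto intro: F)
  qed
  have "q \<in> generate_field real_ring {r}" if "q \<in> \<rat>" for q
    using that int by (auto simp: Rats_eq_int_div_int intro!: F)
  thus "K \<subseteq> generate_field real_ring {r}"
    using r by (auto simp: K_def quad_def intro!: F)
qed

text \<open>The effect of doubling on \<open>u = x / n\<close>. The critical case is that of a unit \<open>u\<close> with \<open>u \<equiv> 1\<close> modulo 2: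
  there \<open>u\<^sup>2 + 1\<close> has valuation exactly 1, while that of \<open>u\<^sup>2 - 1\<close> is at least 2.\<close>

lemma V_doubling:
  assumes "u \<in> K" "u \<noteq> 0" "u \<noteq> 1" "u \<noteq> - 1" "V k u"
  shows "\<exists>l<0. V l ((u\<^sup>2 + 1)\<^sup>2 / (4 * (u * (u\<^sup>2 - 1)))) \<and> (k < 0 \<longrightarrow> l < k)"
proof -
  note F = subfield_type_algebraD[OF subfield_K]
  have uu: "V (2 * k) (u\<^sup>2)" using assms by (intro V_power2)
  have red: "\<exists>l<0. V l ((u\<^sup>2 + 1)\<^sup>2 / (4 * (u * (u\<^sup>2 - 1)))) \<and> (k < 0 \<longrightarrow> l < k)"
    if "V p (u\<^sup>2 + 1)" "V q (u\<^sup>2 - 1)" "2 * p - (2 + (k + q)) < 0" "k < 0 \<longrightarrow> 2 * p - (2 + (k + q)) < k" for p q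
  proof -
    have "V 2 4" using V_power2[OF V_2] by simp
    hence "V (2 * p - (2 + (k + q))) ((u\<^sup>2 + 1)\<^sup>2 / (4 * (u * (u\<^sup>2 - 1))))"
      using that assms by (intro V_divide V_mult V_power2) auto
    thus ?thesis using that(3,4) by blast
  qed
  consider "k < 0" | "k > 0" | "k = 0" by linarith
  thus ?thesis
  proof cases
    case 1
    have "V (2 * k) (u\<^sup>2 + 1)" "V (2 * k) (u\<^sup>2 - 1)"
      using V_add[OF uu V_1] V_add[OF uu V_minus_1] 1 by auto
    thus ?thesis by (rule red) (use 1 in auto)
  next
    case 2
    have "V 0 (u\<^sup>2 + 1)" "V 0 (u\<^sup>2 - 1)"
      using V_add[OF V_1 uu] V_add[OF V_minus_1 uu] 2 by (auto simp: add.commute)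
    thus ?thesis by (rule red) (use 2 in auto)
  next
    case 3
    have fac: "u\<^sup>2 - 1 = (u - 1) * (u + 1)" by (simp add: power2_eq_square algebra_simps)
    have plus: "u\<^sup>2 + 1 = (u\<^sup>2 - 1) + 2" "u + 1 = (u - 1) + 2" by simp_all
    obtain i where i: "V i (u - 1)" using V_exists[of "u - 1"] assms F by auto
    consider "i \<le> 0" | "i = 1" | "i \<ge> 2" by linarith
    thus ?thesis
    proof cases
      case 1
      have "V i (u + 1)" unfolding plus using V_add[OF i V_2] 1 by simp
      hence q: "V (2 * i) (u\<^sup>2 - 1)" unfolding fac using V_mult[OF i] by fastforce
      hence "V (2 * i) (u\<^sup>2 + 1)" unfolding plus using V_add[OF q V_2] 1 by simp
      from this q show ?thesis by (rule red) (use 1 3 in auto)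
    next
      case 2
      define w where "w = (u - 1) / 2"
      have w: "V 0 w" using V_divide[OF i V_2] 2 by (simp add: w_def)
      have w1: "w + 1 = (u + 1) / 2" by (simp add: w_def field_simps)
      have "w + 1 \<in> K" unfolding w1 using assms(1) by (intro F)
      moreover have "w + 1 \<noteq> 0" using assms(4) by (simp add: w1)
      ultimately obtain j where j: "V j (w + 1)" using V_exists by blast
      have "j \<ge> 0"
      proof (rule ccontr)
        assume "\<not> j \<ge> 0"
        hence "V j w" using V_add[OF j V_minus_1] by simp
        thus False using V_unique[OF w] \<open>\<not> j \<ge> 0\<close> by fastforce
      qed
      have "2 * (w + 1) = u + 1" by (simp add: w_def)
      hence "V (1 + j) (u + 1)" using V_mult[OF V_2 j] by metis
      hence q: "V (2 + j) (u\<^sup>2 - 1)" unfolding fac using V_mult[OF i, of "1 + j" "u + 1"] 2 by simp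
      have "V 1 (u\<^sup>2 + 1)" unfolding plus using V_add[OF V_2 q] \<open>j \<ge> 0\<close> by (simp add: add.commute)
      from this q show ?thesis by (rule red) (use 3 \<open>j \<ge> 0\<close> in auto)
    next
      case 3
      have "V 1 (u + 1)" unfolding plus using V_add[OF V_2 i] 3 by (simp add: add.commute)
      hence q: "V (i + 1) (u\<^sup>2 - 1)" unfolding fac using V_mult[OF i] by simp
      have "V 1 (u\<^sup>2 + 1)" unfolding plus using V_add[OF V_2 q] 3 by (simp add: add.commute)
      from this q show ?thesis by (rule red) (use 3 \<open>k = 0\<close> in auto)
    qed
  qed
qed

end

section \<open>The automorphism of a simplest cubic field\<close>

lemma exists_cubic_root:
  "\<exists>r::real. r ^ 3 - of_int t * r\<^sup>2 - (of_int t + 3) * r - 1 = 0"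
proof -
  define m :: real where "m = \<bar>of_int t\<bar> + 4"
  let ?g = "\<lambda>x::real. x ^ 3 - of_int t * x\<^sup>2 - (of_int t + 3) * x - 1"
  have m: "m \<ge> 4" and t: "of_int t \<le> m - 4" by (simp_all add: m_def)
  have "of_int t * m\<^sup>2 \<le> (m - 4) * m\<^sup>2" "(of_int t + 3) * m \<le> (m - 1) * m"
    using t m by (auto intro!: mult_right_mono)
  moreover have "m ^ 3 - (m - 4) * m\<^sup>2 - (m - 1) * m - 1 = 3 * m\<^sup>2 + m - 1"
    by (simp add: power2_eq_square power3_eq_cube algebra_simps)
  ultimately have "?g m \<ge> 0" using m by (smt (verit) zero_le_power2)
  hence "\<exists>x\<ge>0. x \<le> m \<and> ?g x = 0"
    using m by (intro IVT) (auto intro!: continuous_intros)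
  thus ?thesis by blast
qed

lemma theta_root: "simplest_cubic t (theta t)"
proof -
  let ?R = "{x :: real. x ^ 3 - of_int t * x\<^sup>2 - (of_int t + 3) * x - 1 = 0}"
  obtain r where r: "r \<in> ?R" using exists_cubic_root[of t] by blast
  interpret simplest_cubic t r by unfold_locales (use r in simp)
  have "?R \<subseteq> {r, conj_root r, conj_root (conj_root r)}" by (auto simp: factorization)
  hence "finite ?R" by (rule finite_subset) simp
  hence "theta t \<in> ?R" unfolding theta_def using r by (intro Max_in) auto
  thus ?thesis by unfold_locales simp
qed

context simplest_cubic
begin

text \<open>The field automorphism with \<open>r \<mapsto> conj_root r\<close>, extensional outside \<open>K\<close>; the coordinates of an element of \<open>K\<close> are
  unique, so the description determines a value.\<close>

definition \<sigma> :: "real \<Rightarrow> real" where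
  "\<sigma> = (\<lambda>x\<in>K. THE y. \<exists>a\<in>\<rat>. \<exists>b\<in>\<rat>. \<exists>c\<in>\<rat>. x = quad r a b c \<and> y = quad (conj_root r) a b c)"

lemma \<sigma>_quad:
  assumes "a \<in> \<rat>" "b \<in> \<rat>" "c \<in> \<rat>"
  shows "\<sigma> (quad r a b c) = quad (conj_root r) a b c"
proof -
  have "(THE y. \<exists>a'\<in>\<rat>. \<exists>b'\<in>\<rat>. \<exists>c'\<in>\<rat>. quad r a b c = quad r a' b' c' \<and> y = quad (conj_root r) a' b' c')
    = quad (conj_root r) a b c"
    using assms quad_Rats_inject[OF assms] by (intro the_equality) blast+
  thus ?thesis using K_D[OF assms] by (simp add: \<sigma>_def)
qed

lemma KE:
  assumes "x \<in> K"
  obtains a b c where "x = quad r a b c" "a \<in> \<rat>" "b \<in> \<rat>" "c \<in> \<rat>"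
  using assms by (auto simp: K_def)

lemma conj_root_in_K: "conj_root r \<in> K"
  using subfield_type_algebraD[OF subfield_K] r_in_K r_plus_1 by (simp add: conj_root_def)

lemma \<sigma>_in_K: "x \<in> K \<Longrightarrow> \<sigma> x \<in> K"
  by (elim KE) (auto simp: \<sigma>_quad quad_conj intro!: K_D)

lemma \<sigma>_add: "x \<in> K \<Longrightarrow> y \<in> K \<Longrightarrow> \<sigma> (x + y) = \<sigma> x + \<sigma> y"
proof (elim KE)
  fix a b c a' b' c' assume xy: "x = quad r a b c" "y = quad r a' b' c'"
    and R: "a \<in> \<rat>" "b \<in> \<rat>" "c \<in> \<rat>" "a' \<in> \<rat>" "b' \<in> \<rat>" "c' \<in> \<rat>"
  have "x + y = quad r (a + a') (b + b') (c + c')" by (simp add: xy quad_def algebra_simps)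
  hence "\<sigma> (x + y) = quad (conj_root r) (a + a') (b + b') (c + c')" using R by (simp add: \<sigma>_quad)
  also have "\<dots> = \<sigma> x + \<sigma> y" unfolding xy using R by (simp add: \<sigma>_quad) (simp add: quad_def algebra_simps)
  finally show ?thesis .
qed

lemma \<sigma>_mult: "x \<in> K \<Longrightarrow> y \<in> K \<Longrightarrow> \<sigma> (x * y) = \<sigma> x * \<sigma> y"
proof (elim KE)
  fix a b c a' b' c' assume xy: "x = quad r a b c" "y = quad r a' b' c'"
    and R: "a \<in> \<rat>" "b \<in> \<rat>" "c \<in> \<rat>" "a' \<in> \<rat>" "b' \<in> \<rat>" "c' \<in> \<rat>"
  interpret c: simplest_cubic t "conj_root r" by (rule conj_root_conj)
  show ?thesis unfolding xy quad_mult using R by (simp add: \<sigma>_quad c.quad_mult)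
qed

lemma \<sigma>_Rats: "q \<in> \<rat> \<Longrightarrow> \<sigma> q = q"
  using \<sigma>_quad[of q 0 0] by (simp add: quad_def)

lemma \<sigma>_r: "\<sigma> r = conj_root r"
  using \<sigma>_quad[of 0 1 0] by (simp add: quad_def)

lemma hom_quad:
  assumes "\<And>x y. x \<in> K \<Longrightarrow> y \<in> K \<Longrightarrow> s (x + y) = s x + s y"
    and "\<And>x y. x \<in> K \<Longrightarrow> y \<in> K \<Longrightarrow> s (x * y) = s x * s y"
    and "\<And>q. q \<in> \<rat> \<Longrightarrow> s q = q" and "z \<in> K" "a \<in> \<rat>" "b \<in> \<rat>" "c \<in> \<rat>"
  shows "s (quad z a b c) = quad (s z) a b c"
proof -
  have "a \<in> K" "b \<in> K" "c \<in> K" using Rats_subset_K assms by auto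
  thus ?thesis using subfield_type_algebraD[OF subfield_K] assms
    by (simp add: quad_def power2_eq_square)
qed

lemma \<sigma>_conj: "\<sigma> (conj_root r) = conj_root (conj_root r)"
proof -
  interpret c: simplest_cubic t "conj_root r" by (rule conj_root_conj)
  have "conj_root r = quad r (- 2) (- (of_int t + 1)) 1"
    by (simp add: quad_def conj_root_eq algebra_simps)
  hence "\<sigma> (conj_root r) = quad (conj_root r) (- 2) (- (of_int t + 1)) 1" by (simp add: \<sigma>_quad)
  also have "\<dots> = conj_root (conj_root r)" by (simp add: quad_def c.conj_root_eq algebra_simps)
  finally show ?thesis .
qed

lemma \<sigma>_conj_conj: "\<sigma> (conj_root (conj_root r)) = r"
proof -
  have in_K: "of_int t \<in> K" "r \<in> K" "conj_root r \<in> K" "- conj_root r \<in> K" "- r \<in> K" "of_int t - r \<in> K"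
    using Rats_subset_K r_in_K conj_root_in_K by (auto intro!: subfield_type_algebraD[OF subfield_K])
  have "\<sigma> (conj_root (conj_root r)) + \<sigma> (conj_root r) + \<sigma> r = \<sigma> (of_int t)"
    unfolding conj_root_conj_root_eq using in_K subfield_type_algebraD[OF subfield_K]
    by (simp flip: \<sigma>_add)
  thus ?thesis by (simp add: \<sigma>_conj \<sigma>_r \<sigma>_Rats conj_root_conj_root_eq)
qed

lemma \<sigma>_cubed: "x \<in> K \<Longrightarrow> \<sigma> (\<sigma> (\<sigma> x)) = x"
proof (elim KE)
  fix a b c assume x: "x = quad r a b c" "a \<in> \<rat>" "b \<in> \<rat>" "c \<in> \<rat>"
  note h = hom_quad[of \<sigma>, OF \<sigma>_add \<sigma>_mult \<sigma>_Rats]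
  have "conj_root (conj_root r) \<in> K" using \<sigma>_in_K[OF conj_root_in_K] by (simp add: \<sigma>_conj)
  thus ?thesis using x conj_root_in_K by (simp add: \<sigma>_quad h \<sigma>_conj \<sigma>_conj_conj)
qed

lemma \<sigma>_galois: "\<sigma> \<in> carrier (galois_group K \<rat>)"
proof -
  have "bij_betw \<sigma> K K"
    by (rule bij_betw_byWitness[where f' = "\<lambda>x. \<sigma> (\<sigma> x)"]) (auto simp: \<sigma>_cubed \<sigma>_in_K)
  moreover have "\<sigma> \<in> extensional K" by (simp add: \<sigma>_def)
  ultimately show ?thesis
    by (auto simp: galois_group_def Bij_def ring_hom_def \<sigma>_in_K \<sigma>_add \<sigma>_mult \<sigma>_Rats)
qed

lemma galois_cases:
  assumes "s \<in> carrier (galois_group K \<rat>)"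
  shows "s r \<in> {r, conj_root r, conj_root (conj_root r)}"
    and "s \<in> extensional K" and "a \<in> \<rat> \<Longrightarrow> b \<in> \<rat> \<Longrightarrow> c \<in> \<rat> \<Longrightarrow> s (quad r a b c) = quad (s r) a b c"
proof -
  have s: "\<And>x. x \<in> K \<Longrightarrow> s x \<in> K" "\<And>x y. x \<in> K \<Longrightarrow> y \<in> K \<Longrightarrow> s (x + y) = s x + s y"
    "\<And>x y. x \<in> K \<Longrightarrow> y \<in> K \<Longrightarrow> s (x * y) = s x * s y" "\<And>q. q \<in> \<rat> \<Longrightarrow> s q = q"
    using assms by (auto simp: galois_group_def ring_hom_def)
  show "s \<in> extensional K" using assms by (auto simp: galois_group_def Bij_def)
  show quad: "s (quad r a b c) = quad (s r) a b c" if "a \<in> \<rat>" "b \<in> \<rat>" "c \<in> \<rat>" for a b c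
    using hom_quad[of s, OF s(2-4) r_in_K] that by blast
  have in_K: "r * r \<in> K" "quad r 1 (of_int t + 3) (of_int t) \<in> K"
    using subfield_type_algebraD[OF subfield_K] r_in_K by (auto intro!: K_D)
  have "r * (r * r) = quad r 1 (of_int t + 3) (of_int t)"
    using root by (simp add: quad_def power2_eq_square power3_eq_cube)
  hence "s (r * (r * r)) = quad (s r) 1 (of_int t + 3) (of_int t)" using quad by simp
  moreover have "s (r * (r * r)) = s r * (s r * s r)" using s(3) r_in_K in_K by simp
  ultimately have "(s r) ^ 3 - of_int t * (s r)\<^sup>2 - (of_int t + 3) * s r - 1 = 0"
    by (simp add: quad_def power2_eq_square power3_eq_cube algebra_simps)
  thus "s r \<in> {r, conj_root r, conj_root (conj_root r)}" unfolding factorization by simp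
qed

lemma galois_eqI:
  assumes "s \<in> carrier (galois_group K \<rat>)" "s' \<in> carrier (galois_group K \<rat>)" "s r = s' r"
  shows "s = s'"
proof (rule extensionalityI[where A = K])
  show "s \<in> extensional K" "s' \<in> extensional K" using assms galois_cases(2) by auto
  fix x assume "x \<in> K"
  then obtain a b c where x: "x = quad r a b c" "a \<in> \<rat>" "b \<in> \<rat>" "c \<in> \<rat>" by (rule KE)
  show "s x = s' x"
    unfolding x(1) galois_cases(3)[OF assms(1) x(2-4)] galois_cases(3)[OF assms(2) x(2-4)] assms(3) ..
qed

text \<open>An automorphism is determined by the root to which it sends \<open>r\<close>, so the Galois group consists of the identity,
  \<open>\<sigma>\<close> and its square.\<close>

lemma galois_generate: "generate (galois_group K \<rat>) {\<sigma>} = carrier (galois_group K \<rat>)"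
proof -
  let ?G = "galois_group K \<rat>"
  interpret B: group "BijGroup K" by (rule group_BijGroup)
  have "subgroup (carrier ?G) (BijGroup K)"
  proof (rule B.subgroupI)
    show "carrier ?G \<subseteq> carrier (BijGroup K)" by (auto simp: galois_group_def BijGroup_def)
    show "carrier ?G \<noteq> {}" using \<sigma>_galois by blast
  next
    fix s assume s: "s \<in> carrier ?G"
    hence bij: "s \<in> Bij K" and add: "\<And>x y. x \<in> K \<Longrightarrow> y \<in> K \<Longrightarrow> s (x + y) = s x + s y"
      and mult: "\<And>x y. x \<in> K \<Longrightarrow> y \<in> K \<Longrightarrow> s (x * y) = s x * s y"
      and fixed: "\<And>q. q \<in> \<rat> \<Longrightarrow> s q = q"
      by (auto simp: galois_group_def ring_hom_def)
    have "inv_into K s (x + y) = inv_into K s x + inv_into K s y"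
      "inv_into K s (x * y) = inv_into K s x * inv_into K s y" if "x \<in> K" "y \<in> K" for x y
      using Bij_inv_into_lemma[of K s "(+)" x y, OF add bij] Bij_inv_into_lemma[of K s "(*)" x y, OF mult bij]
        that subfield_type_algebraD[OF subfield_K] by auto
    moreover have "inv_into K s q = q" if "q \<in> \<rat>" for q
      using bij fixed that Rats_subset_K by (intro inv_into_f_eq) (auto simp: Bij_def bij_betw_def)
    ultimately show "inv\<^bsub>BijGroup K\<^esub> s \<in> carrier ?G"
      using restrict_inv_into_Bij[OF bij] Bij_inv_into_mem[OF bij] Rats_subset_K
        subfield_type_algebraD[OF subfield_K]
      by (auto simp: inv_BijGroup[OF bij] galois_group_def ring_hom_def)
  next
    fix s s' assume "s \<in> carrier ?G" "s' \<in> carrier ?G"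
    thus "s \<otimes>\<^bsub>BijGroup K\<^esub> s' \<in> carrier ?G"
      using Rats_subset_K subfield_type_algebraD[OF subfield_K]
      by (auto simp: galois_group_def BijGroup_def ring_hom_def compose_Bij[unfolded compose_def] compose_def Pi_iff subset_iff)
  qed
  hence grp: "group ?G"
    unfolding galois_group_def using group.subgroup_imp_group[OF group_BijGroup] by simp
  interpret G: group ?G by (rule grp)
  have one: "\<one>\<^bsub>?G\<^esub> r = r" using r_in_K by (simp add: galois_group_def BijGroup_def)
  have mult: "(\<sigma> \<otimes>\<^bsub>?G\<^esub> \<sigma>) r = conj_root (conj_root r)"
    using \<sigma>_galois r_in_K by (simp add: galois_group_def BijGroup_def compose_def \<sigma>_r \<sigma>_conj)
  show ?thesis
  proof
    show "generate ?G {\<sigma>} \<subseteq> carrier ?G" by (rule G.generate_incl) (use \<sigma>_galois in simp)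
    show "carrier ?G \<subseteq> generate ?G {\<sigma>}"
    proof
      fix s assume s: "s \<in> carrier ?G"
      from galois_cases(1)[OF s] consider "s = \<one>\<^bsub>?G\<^esub>" | "s = \<sigma>" | "s = \<sigma> \<otimes>\<^bsub>?G\<^esub> \<sigma>"
        using galois_eqI[OF s] \<sigma>_galois one mult \<sigma>_r G.one_closed G.m_closed by (metis insertE singletonD)
      thus "s \<in> generate ?G {\<sigma>}"
        by cases (auto intro: generate.intros)
    qed
  qed
qed

end

lemma sigma_eq:
  "cubic_field t = simplest_cubic.K (theta t)" "sigma t = simplest_cubic.\<sigma> (theta t)"
proof -
  interpret simplest_cubic t "theta t" by (rule theta_root)
  show K: "cubic_field t = K" by (simp add: cubic_field_def generate_field_eq_K)
  show "sigma t = \<sigma>"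
    unfolding sigma_def K
    using \<sigma>_galois galois_generate \<sigma>_r
    by (intro the_equality) (auto simp: conj_root_def intro: galois_eqI)
qed

section \<open>Torsion of the congruent number curve over a simplest cubic field\<close>

text \<open>The curve \<open>y\<^sup>2 = x (x - N) (x + N)\<close> over \<open>K\<close>, where \<open>N\<close> is the rational number \<open>n\<close> as a real number. Its group
  \<open>E\<close> carries the coordinatewise action of \<open>\<sigma>\<close>.\<close>

locale congruent_simplest_cubic = simplest_cubic +
  fixes n :: rat
  assumes n_pos: "n > 0"
begin

abbreviation N :: real where "N \<equiv> of_rat n"

abbreviation E :: "real ec_point monoid" where "E \<equiv> congruent_curve n K"

lemma N_pos: "N > 0"
  using n_pos by simp

lemma N_in: "N \<in> K" "- N\<^sup>2 \<in> K"
  using Rats_subset_K by auto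

lemma E_simps:
  "P \<in> carrier E \<longleftrightarrow> on_curve (- N\<^sup>2) 0 P \<and> set_ec_point P \<subseteq> K"
  "P \<otimes>\<^bsub>E\<^esub> Q = ec_add (- N\<^sup>2) P Q" "\<one>\<^bsub>E\<^esub> = Infinity"
  by (simp_all add: congruent_curve_def ec_group_def)

lemma Affine_in_E:
  "Affine x y \<in> carrier E \<longleftrightarrow> x \<in> K \<and> y \<in> K \<and> y\<^sup>2 = x * (x - N) * (x + N)"
proof -
  have "x ^ 3 + (- N\<^sup>2) * x + 0 = x * (x - N) * (x + N)"
    by (simp add: power2_eq_square power3_eq_cube algebra_simps)
  thus ?thesis by (auto simp: E_simps on_curve_def)
qed

lemma comm_group_congruent_curve: "subfield F real_ring \<Longrightarrow> comm_group (congruent_curve n F)"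
proof -
  assume F: "subfield F real_ring"
  note F' = subfield_type_algebraD[OF F]
  have int: "of_int m \<in> F" for m
  proof -
    have "of_nat k \<in> F" for k by (induction k) (auto intro: F')
    thus ?thesis by (cases m rule: int_cases2) (auto intro: F')
  qed
  have "N \<in> F"
  proof -
    have "N \<in> \<rat>" by simp
    thus ?thesis using int by (auto simp: Rats_eq_int_div_int intro!: F')
  qed
  hence "- N\<^sup>2 \<in> F" by (intro F')
  thus ?thesis unfolding congruent_curve_def
    using N_pos by (intro comm_group_ec_group[OF F]) auto
qed

sublocale A: order_three_action E "map_ec_point \<sigma>"
proof (intro order_three_action.intro order_three_action_axioms.intro)
  show "comm_group E" by (rule comm_group_congruent_curve[OF subfield_K])
  show "map_ec_point \<sigma> \<in> hom E E"
    unfolding congruent_curve_def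
    using \<sigma>_in_K \<sigma>_add \<sigma>_mult \<sigma>_Rats N_in Rats_subset_K
    by (intro map_ec_point_hom[OF subfield_K]) auto
  fix P assume "P \<in> carrier E"
  thus "map_ec_point \<sigma> (map_ec_point \<sigma> (map_ec_point \<sigma> P)) = P"
    by (cases P) (auto simp: E_simps \<sigma>_cubed)
qed

lemma inv_E: "P \<in> carrier E \<Longrightarrow> inv\<^bsub>E\<^esub> P = ec_neg P"
  using set_ec_neg[OF subfield_K, of P]
  by (intro A.comm_inv_char) (auto simp: E_simps)

lemma E_double:
  assumes "Affine x y \<in> carrier E" "y \<noteq> 0"
  obtains x' y' where "Affine x y \<otimes>\<^bsub>E\<^esub> Affine x y = Affine x' y'"
    and "x' / N = ((x / N)\<^sup>2 + 1)\<^sup>2 / (4 * (x / N * ((x / N)\<^sup>2 - 1)))"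
proof -
  define x' where "x' = ((3 * x\<^sup>2 - N\<^sup>2) / (2 * y))\<^sup>2 - x - x"
  have y2: "y\<^sup>2 = x * (x - N) * (x + N)" using assms by (simp add: Affine_in_E)
  have "4 * y\<^sup>2 * x' = (3 * x\<^sup>2 - N\<^sup>2)\<^sup>2 - 8 * x * y\<^sup>2"
    using assms(2) by (simp add: x'_def power2_eq_square field_simps)
  hence eq: "4 * (x * (x - N) * (x + N)) * x' = (x\<^sup>2 + N\<^sup>2)\<^sup>2"
    unfolding y2 by Groebner_Basis.algebra
  have "x * (x - N) * (x + N) \<noteq> 0" using y2 assms(2) by (metis power_not_zero)
  hence "x' = 4 * (x * (x - N) * (x + N)) * x' / (4 * (x * (x - N) * (x + N)))" by simp
  hence x': "x' = (x\<^sup>2 + N\<^sup>2)\<^sup>2 / (4 * (x * (x - N) * (x + N)))" unfolding eq .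
  define u where "u = x / N"
  have x: "x = u * N" using N_pos by (simp add: u_def)
  have "x' / N = (N\<^sup>2 * N\<^sup>2 * (u\<^sup>2 + 1)\<^sup>2) / (N\<^sup>2 * N\<^sup>2 * (4 * (u * (u\<^sup>2 - 1))))"
    unfolding x' x by (simp add: power2_eq_square algebra_simps)
  hence "x' / N = (u\<^sup>2 + 1)\<^sup>2 / (4 * (u * (u\<^sup>2 - 1)))" using N_pos by simp
  moreover have "Affine x y \<otimes>\<^bsub>E\<^esub> Affine x y =
      Affine x' ((3 * x\<^sup>2 - N\<^sup>2) / (2 * y) * (x - x') - y)"
    using assms(2) by (simp add: E_simps x'_def Let_def)
  ultimately show thesis using that by (simp add: u_def)
qed

lemma V_double:
  assumes "Affine x y \<in> carrier E" "y \<noteq> 0"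
  shows "\<exists>x' y' l. Affine x y \<otimes>\<^bsub>E\<^esub> Affine x y = Affine x' y' \<and> V l (x' / N) \<and> l < 0 \<and>
    (\<forall>k. V k (x / N) \<longrightarrow> k < 0 \<longrightarrow> l < k)"
proof -
  have x: "x \<in> K" "x \<noteq> 0" "x \<noteq> N" "x \<noteq> - N" using assms by (auto simp: Affine_in_E)
  have u: "x / N \<in> K" "x / N \<noteq> 0" "x / N \<noteq> 1" "x / N \<noteq> - 1"
    using x N_pos N_in subfield_type_algebraD(7)[OF subfield_K] by (auto simp: field_simps)
  then obtain k where k: "V k (x / N)" using V_exists by blast
  obtain x' y' where "Affine x y \<otimes>\<^bsub>E\<^esub> Affine x y = Affine x' y'"
    and w: "x' / N = ((x / N)\<^sup>2 + 1)\<^sup>2 / (4 * (x / N * ((x / N)\<^sup>2 - 1)))"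
    using E_double[OF assms] .
  moreover obtain l where "l < 0" "V l (x' / N)" "k < 0 \<longrightarrow> l < k"
    using V_doubling[OF u k] unfolding w by blast
  moreover have "\<forall>k'. V k' (x / N) \<longrightarrow> k' = k" using k V_unique by blast
  ultimately show ?thesis by blast
qed

text \<open>If \<open>Q\<close> had finite order, then among its finitely many multiples with \<open>v(x / n) < 0\<close> there would be one with the
  least valuation; its double is a multiple of \<open>Q\<close> with a smaller one.\<close>

lemma infinite_order:
  assumes Q: "Affine x y \<in> carrier E" "y \<noteq> 0"
    and k: "Affine x y [^]\<^bsub>E\<^esub> (k :: int) = \<one>\<^bsub>E\<^esub>"
  shows "k = 0"
proof (rule ccontr)
  assume "k \<noteq> 0"
  define m where "m = nat \<bar>k\<bar>"
  have "m > 0" using \<open>k \<noteq> 0\<close> by (simp add: m_def)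
  have "Affine x y [^]\<^bsub>E\<^esub> int m = \<one>\<^bsub>E\<^esub>"
  proof (cases "k \<ge> 0")
    case False
    hence "int m = - k" by (simp add: m_def)
    thus ?thesis by (simp only: A.int_pow_neg[OF Q(1)] k A.inv_one)
  qed (simp add: m_def k)
  hence m: "Affine x y [^]\<^bsub>E\<^esub> m = \<one>\<^bsub>E\<^esub>" by (simp add: int_pow_int)
  define pts where "pts = range (\<lambda>i::nat. Affine x y [^]\<^bsub>E\<^esub> i)"
  have "Affine x y [^]\<^bsub>E\<^esub> i \<in> (\<lambda>i. Affine x y [^]\<^bsub>E\<^esub> i) ` {..<m}" for i :: nat
  proof -
    have "Affine x y [^]\<^bsub>E\<^esub> (m * (i div m)) = \<one>\<^bsub>E\<^esub>"
      unfolding A.nat_pow_pow[OF Q(1), symmetric] m by (rule A.nat_pow_one)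
    moreover have "Affine x y [^]\<^bsub>E\<^esub> (m * (i div m)) \<otimes>\<^bsub>E\<^esub> Affine x y [^]\<^bsub>E\<^esub> (i mod m)
        = Affine x y [^]\<^bsub>E\<^esub> i"
      unfolding A.nat_pow_mult[OF Q(1)] mult_div_mod_eq ..
    ultimately have "Affine x y [^]\<^bsub>E\<^esub> i = Affine x y [^]\<^bsub>E\<^esub> (i mod m)"
      using A.l_one[OF A.nat_pow_closed[OF Q(1)]] by metis
    thus ?thesis by (rule image_eqI) (use \<open>m > 0\<close> in simp)
  qed
  hence "pts \<subseteq> (\<lambda>i. Affine x y [^]\<^bsub>E\<^esub> i) ` {..<m}" unfolding pts_def by blast
  hence "finite pts" by (rule finite_subset) simp
  define vals where "vals = {l. l < 0 \<and> (\<exists>x y. Affine x y \<in> pts \<and> V l (x / N))}"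
  have "vals \<subseteq> (\<lambda>P. THE l. \<exists>x y. P = Affine x y \<and> V l (x / N)) ` pts"
  proof
    fix l assume "l \<in> vals"
    then obtain x y where xy: "Affine x y \<in> pts" "V l (x / N)" by (auto simp: vals_def)
    have "(THE l. \<exists>x' y'. Affine x y = Affine x' y' \<and> V l (x' / N)) = l"
      using xy(2) V_unique by (intro the_equality) auto
    thus "l \<in> (\<lambda>P. THE l. \<exists>x y. P = Affine x y \<and> V l (x / N)) ` pts"
      using xy(1) by (intro image_eqI[of _ _ "Affine x y"]) simp_all
  qed
  hence fin: "finite vals" using \<open>finite pts\<close> by (meson finite_imageI finite_subset)
  have pts_double: "P \<otimes>\<^bsub>E\<^esub> P \<in> pts" if "P \<in> pts" for P
  proof -
    obtain i :: nat where "P = Affine x y [^]\<^bsub>E\<^esub> i" using \<open>P \<in> pts\<close> by (auto simp: pts_def)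
    hence "P \<otimes>\<^bsub>E\<^esub> P = Affine x y [^]\<^bsub>E\<^esub> (i + i)" by (simp add: A.nat_pow_mult[OF Q(1)])
    thus ?thesis by (auto simp: pts_def)
  qed
  have pts_E: "P \<in> carrier E" if "P \<in> pts" for P
    using that Q by (auto simp: pts_def)
  have "Affine x y \<in> pts" unfolding pts_def by (rule range_eqI[of _ _ 1]) (simp add: Q)
  note double = pts_double[OF this]
  obtain x1 y1 l
    where "Affine x y \<otimes>\<^bsub>E\<^esub> Affine x y = Affine x1 y1" "V l (x1 / N)" "l < 0"
    using V_double[OF Q] by blast
  hence "l \<in> vals" using double by (auto simp: vals_def)
  define l0 where "l0 = Min vals"
  have "l0 \<in> vals" unfolding l0_def using fin \<open>l \<in> vals\<close> by (intro Min_in) auto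
  then obtain x0 y0 where l0: "l0 < 0" "Affine x0 y0 \<in> pts" "V l0 (x0 / N)" by (auto simp: vals_def)
  have "y0 \<noteq> 0"
  proof
    assume "y0 = 0"
    hence "x0 = 0 \<or> x0 = N \<or> x0 = - N" using pts_E[OF l0(2)] by (auto simp: Affine_in_E)
    hence "x0 / N = 0 \<or> x0 / N = 1 \<or> x0 / N = - 1" using N_pos by auto
    thus False
    proof (elim disjE)
      assume "x0 / N = 0"
      thus False using V_nonzero[OF l0(3)] by simp
    next
      assume 1: "x0 / N = 1"
      show False using V_unique[OF l0(3)[unfolded 1] V_1] l0(1) by simp
    next
      assume 1: "x0 / N = - 1"
      show False using V_unique[OF l0(3)[unfolded 1] V_minus_1] l0(1) by simp
    qed
  qed
  from V_double[OF pts_E[OF l0(2)] this] obtain x' y' l' where "Affine x0 y0 \<otimes>\<^bsub>E\<^esub> Affine x0 y0 = Affine x' y'" "V l' (x' / N)" "l' < 0"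
      and less: "\<forall>k. V k (x0 / N) \<longrightarrow> k < 0 \<longrightarrow> l' < k" by blast
  hence "l' \<in> vals" using pts_double[OF l0(2)] by (auto simp: vals_def)
  hence "l0 \<le> l'" unfolding l0_def using fin by (intro Min_le) auto
  thus False using less l0(1,3) by fastforce
qed

lemma torsion_cases:
  assumes "Q \<in> carrier E" "Q [^]\<^bsub>E\<^esub> (k :: int) = \<one>\<^bsub>E\<^esub>" "k \<noteq> 0"
  shows "Q = \<one>\<^bsub>E\<^esub> \<or> (\<exists>e\<in>{0, N, - N}. Q = Affine e 0)"
proof (cases Q)
  case (Affine x y)
  hence "y = 0" using infinite_order assms by blast
  thus ?thesis using assms(1) Affine by (auto simp: Affine_in_E)
qed (simp add: E_simps)

lemma torsion_square:
  assumes "Q \<in> carrier E" "Q [^]\<^bsub>E\<^esub> (k :: int) = \<one>\<^bsub>E\<^esub>" "k \<noteq> 0"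
  shows "Q \<otimes>\<^bsub>E\<^esub> Q = \<one>\<^bsub>E\<^esub>" "map_ec_point \<sigma> Q = Q"
  using torsion_cases[OF assms] \<sigma>_Rats[of 0] \<sigma>_Rats[of N] \<sigma>_Rats[of "- N"] by (auto simp: E_simps)

lemma conj_ne: "r \<noteq> conj_root r"
proof
  assume "r = conj_root r"
  hence "quad r 0 1 0 = quad r (- 2) (- (of_int t + 1)) 1" 
    by (simp add: quad_def conj_root_eq algebra_simps)
  thus False using quad_Rats_inject[of 0 1 0 "- 2" "- (of_int t + 1)" 1] by simp
qed

lemma fixed_by_\<sigma>_not_conj:
  assumes "P \<in> carrier E" "P = Affine (r - 1) y"
  shows "map_ec_point \<sigma> P \<noteq> P"
proof -
  have "\<sigma> (r - 1) = conj_root r - 1"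
    using \<sigma>_quad[of "- 1" 1 0] by (simp add: quad_def)
  thus ?thesis using assms conj_ne by auto
qed

section \<open>The trace is not a point of order two\<close>

lemma V_quad_int: "odd a \<or> odd b \<or> odd c \<Longrightarrow> V 0 (quad_int r a b c)"
  by (rule VI[of 1 a b c]) auto

text \<open>Adding a rational number \<open>q\<close> changes only the first coordinate, so an odd second or third coordinate keeps the
  valuation at 0 as long as \<open>q\<close> is 2-integral.\<close>

lemma V_shifted_Rats:
  assumes "odd b \<or> odd c" "V k q" "q \<in> \<rat>"
  shows "V (min k 0) (quad_int r a b c + q)"
proof (cases "k < 0")
  case True
  have "V 0 (quad_int r a b c)" using assms(1) by (intro V_quad_int) auto
  from V_add[OF assms(2) this True] show ?thesis using True by (simp add: add.commute)
next
  case False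
  obtain i j :: int where q: "j \<noteq> 0" "q = of_int i / of_int j"
    using assms(3) unfolding Rats_eq_int_div_int by auto
  have "i \<noteq> 0" using V_nonzero[OF assms(2)] q by auto
  then obtain p i' where i: "i = 2 ^ p * i'" "odd i'"
    using int_triple_primitive[of i 0 0] by auto
  obtain p' j' where j: "j = 2 ^ p' * j'" "odd j'"
    using int_triple_primitive[of j 0 0] q(1) by auto
  have "j' \<noteq> 0" using j(2) by auto
  hence qj: "q * of_int j' = 2 powi (int p - int p') * of_int i'"
    unfolding q(2) i(1) j(1) by (simp add: power_int_diff)
  have "V (int p - int p') q"
    by (rule VI[OF j(2) disjI1[OF i(2)], where b = 0 and c = 0]) (simp add: qj quad_def)
  hence k: "k = int p - int p'" using V_unique assms(2) by blast
  define e where "e = nat k"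
  have "k = int e" using False by (simp add: e_def)
  hence "q * of_int j' = 2 ^ e * of_int i'" using qj k by simp
  hence "(quad_int r a b c + q) * of_int j' = 2 powi 0 * quad_int r (a * j' + 2 ^ e * i') (b * j') (c * j')"
    by (simp add: quad_def algebra_simps)
  moreover have "odd (a * j' + 2 ^ e * i') \<or> odd (b * j') \<or> odd (c * j')" using assms(1) j(2) by simp
  ultimately have "V 0 (quad_int r a b c + q)" using VI[OF j(2)] by blast
  thus ?thesis using False by simp
qed

lemma V_N: obtains k where "V k N"
  using V_exists[OF N_in(1)] N_pos by auto

lemma root_minus_1_quad:
  "r - 1 = quad_int r (- 1) 1 0"
  "conj_root r - 1 = quad_int r (- 3) (- t - 1) 1"
  "conj_root (conj_root r) - 1 = quad_int r (t + 1) t (- 1)"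
  unfolding conj_root_conj_root_eq unfolding conj_root_eq by (simp_all add: quad_def algebra_simps)

lemma norm_root_minus_1:
  "(r - 1) * (conj_root r - 1) * (conj_root (conj_root r) - 1) = 2 * of_int t + 3"
  using factorization[of 1] by (simp add: algebra_simps)

lemma root_minus_1_irrational:
  assumes "q \<in> \<rat>"
  shows "r - 1 \<noteq> q" "conj_root r - 1 \<noteq> q" "conj_root (conj_root r) - 1 \<noteq> q"
proof -
  have irr: "quad_int r a b c \<noteq> q" if "b \<noteq> 0 \<or> c \<noteq> 0" for a b c
  proof
    assume "quad_int r a b c = q"
    hence "quad r (of_int a) (of_int b) (of_int c) = quad r q 0 0" by (simp add: quad_def)
    from quad_Rats_inject[OF _ _ _ assms _ _ this] show False using that by simp
  qed
  show "r - 1 \<noteq> q" "conj_root r - 1 \<noteq> q" "conj_root (conj_root r) - 1 \<noteq> q"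
    unfolding root_minus_1_quad by (rule irr; simp)+
qed

lemma E_add_root_square:
  assumes "Affine x1 y1 \<in> carrier E" "Affine x2 y2 \<in> carrier E"
    and "Affine x1 y1 \<otimes>\<^bsub>E\<^esub> Affine x2 y2 = Affine x y" and "e \<in> {0, N, - N}"
  shows "\<exists>u\<in>K. (x1 - e) * (x2 - e) * (x - e) = u\<^sup>2"
proof (rule ec_add_root_square[OF subfield_K])
  show "{x1, y1, x2, y2, - N\<^sup>2, e} \<subseteq> K"
    using assms N_in subfield_type_algebraD[OF subfield_K] by (auto simp: E_simps)
  show "e ^ 3 + (- N\<^sup>2) * e + 0 = 0" using assms(4) by (auto simp: power2_eq_square power3_eq_cube)
qed (use assms in \<open>auto simp: E_simps\<close>)

context
  fixes P y
  assumes t: "t \<ge> - 1" and P: "P = Affine (r - 1) y" "P \<in> carrier E"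
begin

lemma conj_P:
  "map_ec_point \<sigma> P = Affine (conj_root r - 1) (\<sigma> y)"
  "map_ec_point \<sigma> (map_ec_point \<sigma> P) = Affine (conj_root (conj_root r) - 1) (\<sigma> (\<sigma> y))"
proof -
  have "\<sigma> (r - 1) = conj_root r - 1"
    using \<sigma>_quad[of "- 1" 1 0] by (simp add: quad_def)
  thus 1: "map_ec_point \<sigma> P = Affine (conj_root r - 1) (\<sigma> y)" using P by simp
  have "\<sigma> (conj_root r + - 1) = \<sigma> (conj_root r) + \<sigma> (- 1)"
    using conj_root_in_K Rats_subset_K by (intro \<sigma>_add) auto
  thus "map_ec_point \<sigma> (map_ec_point \<sigma> P) = Affine (conj_root (conj_root r) - 1) (\<sigma> (\<sigma> y))"
    unfolding 1 by (simp add: \<sigma>_conj \<sigma>_Rats)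
qed

text \<open>The point \<open>R = P + \<sigma>P = (e0, 0) - \<sigma>\<^sup>2P\<close> is a sum in two ways. Applying \<open>ec_add_root_square\<close> to both and
  multiplying, the factor \<open>(x(R) - e)\<^sup>2\<close> drops out.\<close>

lemma trace_eq_two_torsion_square:
  assumes tr: "P \<otimes>\<^bsub>E\<^esub> map_ec_point \<sigma> P \<otimes>\<^bsub>E\<^esub> map_ec_point \<sigma> (map_ec_point \<sigma> P) = Affine e0 0"
    and e: "e0 \<in> {0, N, - N}" "e \<in> {0, N, - N}"
  shows "\<exists>z\<in>K. (r - 1 - e) * (conj_root r - 1 - e) * (conj_root (conj_root r) - 1 - e) * (e0 - e) = z\<^sup>2"
proof -
  define Q where "Q = map_ec_point \<sigma> P"
  define S where "S = map_ec_point \<sigma> Q"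
  define T where "T = Affine e0 0"
  have in_E: "P \<in> carrier E" "Q \<in> carrier E" "S \<in> carrier E"
    using P(2) by (simp_all add: Q_def S_def)
  have T: "T \<in> carrier E"
    unfolding T_def tr[symmetric] using in_E by (simp add: Q_def S_def)
  have Q: "Q = Affine (conj_root r - 1) (\<sigma> y)" and S: "S = Affine (conj_root (conj_root r) - 1) (\<sigma> (\<sigma> y))"
    unfolding Q_def S_def by (rule conj_P)+
  define R where "R = P \<otimes>\<^bsub>E\<^esub> Q"
  have R: "R \<in> carrier E" using in_E by (simp add: R_def)
  have "R \<otimes>\<^bsub>E\<^esub> S = T" using tr by (simp add: R_def Q_def S_def T_def)
  hence RT: "R = T \<otimes>\<^bsub>E\<^esub> ec_neg S"
    using A.inv_solve_right[OF R T in_E(3)] inv_E[OF in_E(3)] by simp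
  have "R \<noteq> Infinity"
  proof
    assume "R = Infinity"
    hence "S = T" using \<open>R \<otimes>\<^bsub>E\<^esub> S = T\<close> by (simp add: E_simps)
    hence "conj_root (conj_root r) - 1 = e0" by (simp add: S T_def)
    thus False using root_minus_1_irrational(3)[of e0] e(1) by auto
  qed
  then obtain xR yR where xR: "R = Affine xR yR" by (cases R) auto
  \<comment> \<open>otherwise \<open>R\<close> would be rational, and applying \<open>\<sigma>\<close> to \<open>R = P + \<sigma>P\<close> would give \<open>\<sigma>\<^sup>2P = P\<close>\<close>
  have "xR \<noteq> e"
  proof
    assume "xR = e"
    hence "yR = 0" using R e(2) xR by (auto simp: Affine_in_E)
    hence "map_ec_point \<sigma> R = R" using xR \<open>xR = e\<close> e(2) \<sigma>_Rats by auto
    hence "Q \<otimes>\<^bsub>E\<^esub> S = P \<otimes>\<^bsub>E\<^esub> Q"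
      using hom_mult[OF A.s_hom in_E(1,2)] by (simp add: R_def Q_def S_def)
    hence "S = P" using in_E A.m_comm[of P Q] by simp
    hence "map_ec_point \<sigma> S = Q" by (simp add: Q_def)
    hence "P = Q" using A.s_cubed[OF in_E(1)] by (simp add: S_def Q_def)
    thus False using fixed_by_\<sigma>_not_conj[OF P(2,1)] by (simp add: Q_def)
  qed
  have "\<exists>u\<in>K. (r - 1 - e) * (conj_root r - 1 - e) * (xR - e) = u\<^sup>2"
    by (rule E_add_root_square[OF in_E(1)[unfolded P(1)] in_E(2)[unfolded Q] xR[unfolded R_def P(1) Q] e(2)])
  then obtain u where u: "u \<in> K" "(r - 1 - e) * (conj_root r - 1 - e) * (xR - e) = u\<^sup>2" by blast
  have negS: "Affine (conj_root (conj_root r) - 1) (- \<sigma> (\<sigma> y)) \<in> carrier E"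
    using A.inv_closed[OF in_E(3)] unfolding inv_E[OF in_E(3)] unfolding S by simp
  have "Affine e0 0 \<otimes>\<^bsub>E\<^esub> Affine (conj_root (conj_root r) - 1) (- \<sigma> (\<sigma> y)) = Affine xR yR"
    using RT unfolding xR S T_def by simp
  from E_add_root_square[OF T[unfolded T_def] negS this e(2)]
  obtain v where v: "v \<in> K" "(e0 - e) * (conj_root (conj_root r) - 1 - e) * (xR - e) = v\<^sup>2" by blast
  have "xR \<in> K" "e \<in> K" using R xR e(2) Rats_subset_K by (auto simp: E_simps)
  hence "u * v / (xR - e) \<in> K" using u v subfield_type_algebraD[OF subfield_K] by simp
  moreover have "(r - 1 - e) * (conj_root r - 1 - e) * (conj_root (conj_root r) - 1 - e) * (e0 - e)
      = (u * v / (xR - e))\<^sup>2"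
  proof -
    have "(u * v / (xR - e))\<^sup>2 = u\<^sup>2 * v\<^sup>2 / ((xR - e) * (xR - e))"
      by (simp add: power2_eq_square)
    thus ?thesis using \<open>xR \<noteq> e\<close> unfolding u(2)[symmetric] v(2)[symmetric] by simp
  qed
  ultimately show ?thesis by blast
qed

lemma trace_not_two_torsion:
  assumes "e0 \<in> {0, N, - N}"
  shows "P \<otimes>\<^bsub>E\<^esub> map_ec_point \<sigma> P \<otimes>\<^bsub>E\<^esub> map_ec_point \<sigma> (map_ec_point \<sigma> P) \<noteq> Affine e0 0"
proof
  assume tr: "P \<otimes>\<^bsub>E\<^esub> map_ec_point \<sigma> P \<otimes>\<^bsub>E\<^esub> map_ec_point \<sigma> (map_ec_point \<sigma> P) = Affine e0 0"
  note sq = trace_eq_two_torsion_square[OF tr assms]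
  define u v where uv: "u = conj_root r" "v = conj_root u"
  have norm: "(r - 1) * (u - 1) * (v - 1) = 2 * of_int t + 3"
    using norm_root_minus_1 by (simp add: uv)
  have pos: "2 * real_of_int t + 3 > 0" using t by linarith
  consider "e0 = 0" | "e0 = - N" | "e0 = N" using assms by auto
  thus False
  proof cases
    case 1
    obtain z1 where z1: "(r - 1 - N) * (u - 1 - N) * (v - 1 - N) * (0 - N) = z1\<^sup>2"
      using sq[of N] 1 by (auto simp: uv)
    obtain z2 where z2: "(r - 1 + N) * (u - 1 + N) * (v - 1 + N) * N = z2\<^sup>2"
      using sq[of "- N"] 1 by (auto simp: uv)
    have Q: "map_ec_point \<sigma> P \<in> carrier E" using P(2) by simp
    have S: "map_ec_point \<sigma> (map_ec_point \<sigma> P) \<in> carrier E" using P(2) by simp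
    have "y\<^sup>2 = (r - 1) * (r - 1 - N) * (r - 1 + N)"
      using P(2) unfolding P(1) Affine_in_E by simp
    moreover have "(\<sigma> y)\<^sup>2 = (u - 1) * (u - 1 - N) * (u - 1 + N)"
      using Q unfolding conj_P(1) Affine_in_E uv by simp
    moreover have "(\<sigma> (\<sigma> y))\<^sup>2 = (v - 1) * (v - 1 - N) * (v - 1 + N)"
      using S unfolding conj_P(2) Affine_in_E uv by simp
    moreover define w A B where "w = y * \<sigma> y * \<sigma> (\<sigma> y)"
      and "A = (r - 1 - N) * (u - 1 - N) * (v - 1 - N)"
      and "B = (r - 1 + N) * (u - 1 + N) * (v - 1 + N)"
    ultimately have "w\<^sup>2 = ((r - 1) * (u - 1) * (v - 1)) * A * B"
      by (simp add: power_mult_distrib)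
    hence "w\<^sup>2 = (2 * of_int t + 3) * A * B" unfolding norm .
    \<comment> \<open>a sum of two nonnegative terms, the second of which is nonzero\<close>
    hence "N\<^sup>2 * w\<^sup>2 + (2 * of_int t + 3) * (z1\<^sup>2 * z2\<^sup>2) = 0"
      unfolding z1[symmetric] z2[symmetric] A_def[symmetric] B_def[symmetric]
      by (simp add: power2_eq_square)
    moreover have "N\<^sup>2 * w\<^sup>2 \<ge> 0" "(2 * of_int t + 3) * (z1\<^sup>2 * z2\<^sup>2) \<ge> 0" using pos by simp_all
    ultimately have "(2 * of_int t + 3) * (z1\<^sup>2 * z2\<^sup>2) = 0" by linarith
    hence "z1\<^sup>2 * z2\<^sup>2 = 0" using pos by (metis less_irrefl mult_eq_0_iff)
    hence "r - 1 = N \<or> u - 1 = N \<or> v - 1 = N \<or> r - 1 = - N \<or> u - 1 = - N \<or> v - 1 = - N"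
      unfolding z1[symmetric] z2[symmetric] using N_pos by auto
    thus False using root_minus_1_irrational[of N] root_minus_1_irrational[of "- N"] by (simp add: uv)
  next
    case 2
    then obtain z where "(r - 1) * (u - 1) * (v - 1) * (- N) = z\<^sup>2" using sq[of 0] by (auto simp: uv)
    hence "z\<^sup>2 = - ((2 * of_int t + 3) * N)" unfolding norm by simp
    moreover have "z\<^sup>2 \<ge> 0" by simp
    ultimately show False using mult_pos_pos[OF pos N_pos] by linarith
  next
    case 3
    obtain k where k: "V k N" using V_N .
    have V0: "V 0 (r - 1)" "V 0 (u - 1)" "V 0 (v - 1)"
      unfolding uv root_minus_1_quad by (rule V_quad_int; simp)+
    obtain z where "z \<in> K" and z: "(r - 1) * (u - 1) * (v - 1) * N = z\<^sup>2"
      using sq[of 0] 3 by (auto simp: uv)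
    have Vz: "V (0 + 0 + 0 + k) (z\<^sup>2)" unfolding z[symmetric] by (intro V_mult V0 k)
    hence "z \<noteq> 0" using V_nonzero by fastforce
    then obtain j where "V j z" using V_exists \<open>z \<in> K\<close> by blast
    hence "0 + 0 + 0 + k = 2 * j" using V_unique[OF Vz V_power2] by blast
    hence k_even: "k = 2 * j" by simp
    have V1: "V (min k 0) (r - 1 + N)" "V (min k 0) (u - 1 + N)" "V (min k 0) (v - 1 + N)"
      unfolding uv root_minus_1_quad by (rule V_shifted_Rats[OF _ k]; simp)+
    obtain z' where "z' \<in> K" and z': "(r - 1 + N) * (u - 1 + N) * (v - 1 + N) * (2 * N) = z'\<^sup>2"
      using sq[of "- N"] 3 by (auto simp: uv)
    have Vz': "V (min k 0 + min k 0 + min k 0 + (1 + k)) (z'\<^sup>2)"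
      unfolding z'[symmetric] by (intro V_mult V1 k V_2)
    hence "z' \<noteq> 0" using V_nonzero by fastforce
    then obtain j' where "V j' z'" using V_exists \<open>z' \<in> K\<close> by blast
    hence eq: "min k 0 + min k 0 + min k 0 + (1 + k) = 2 * j'" using V_unique[OF Vz' V_power2] by blast
    show False
    proof (cases "k < 0")
      case True
      hence "4 * k + 1 = 2 * j'" using eq by simp
      thus False by presburger
    next
      case False
      hence "1 + 2 * j = 2 * j'" using eq k_even by simp
      thus False by presburger
    qed
  qed
qed

end

end

section \<open>Ranks of the groups of points\<close>

context congruent_simplest_cubic
begin

text \<open>The points \<open>P\<close> and \<open>P - \<sigma>P\<close> have infinite order because torsion points are fixed by \<open>\<sigma>\<close>.\<close>

lemma P_nontorsion:
  assumes "P = Affine (r - 1) y" "P \<in> carrier E" "P [^]\<^bsub>E\<^esub> (k :: int) = \<one>\<^bsub>E\<^esub>"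
  shows "k = 0"
proof (rule ccontr)
  assume "k \<noteq> 0"
  from torsion_square(2)[OF assms(2,3) this] fixed_by_\<sigma>_not_conj[OF assms(2,1)] show False by blast
qed

lemma conj_difference_nontorsion:
  assumes "P = Affine (r - 1) y" "P \<in> carrier E" "A.orb P 1 (- 1) 0 [^]\<^bsub>E\<^esub> (k :: int) = \<one>\<^bsub>E\<^esub>"
  shows "k = 0"
proof (rule ccontr)
  assume "k \<noteq> 0"
  let ?D = "A.orb P 1 (- 1) 0"
  note P = assms(2)
  have D: "?D \<in> carrier E" using P by simp
  note sq = torsion_square[OF D assms(3) \<open>k \<noteq> 0\<close>]
  have "A.orb P 0 1 (- 1) = ?D" using A.s_orb[OF P, of 1 "- 1" 0] sq(2) by simp
  moreover have "A.orb P (- 1) 0 1 = ?D"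
    using A.s_orb[OF P, of 0 1 "- 1"] sq(2) calculation by simp
  moreover have "A.orb P 1 (- 1) 0 \<otimes>\<^bsub>E\<^esub> A.orb P 0 1 (- 1) \<otimes>\<^bsub>E\<^esub> A.orb P (- 1) 0 1 = \<one>\<^bsub>E\<^esub>"
    by (simp add: A.orb_mult[OF P]) (simp add: A.orb_def P)
  ultimately have "?D \<otimes>\<^bsub>E\<^esub> ?D \<otimes>\<^bsub>E\<^esub> ?D = \<one>\<^bsub>E\<^esub>" by simp
  hence "?D = \<one>\<^bsub>E\<^esub>" using sq(1) D by simp
  moreover have "A.orb P 1 (- 1) 0 \<otimes>\<^bsub>E\<^esub> A.orb P 0 1 0 = P"
    by (simp add: A.orb_mult[OF P]) (simp add: A.orb_def P)
  ultimately have "map_ec_point \<sigma> P = P" using P by (simp add: A.orb_one)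
  thus False using fixed_by_\<sigma>_not_conj[OF P assms(1)] by blast
qed

lemma fixed_by_\<sigma>: "P \<in> carrier (congruent_curve n \<rat>) \<Longrightarrow> map_ec_point \<sigma> P = P"
  by (cases P) (auto simp: congruent_curve_def ec_group_def \<sigma>_Rats)

lemma rank_growth:
  assumes P: "P = Affine (r - 1) y" "P \<in> carrier E"
  shows "ab_rank (congruent_curve n \<rat>) + 2 \<le> ab_rank E"
proof -
  have "ab_rank (congruent_curve n \<rat>) + enat 2 \<le> ab_rank E"
  proof (rule ab_rank_geI)
    fix S assume S: "int_independent (congruent_curve n \<rat>) S"
    have SQ: "S \<subseteq> carrier (congruent_curve n \<rat>)" using S by (simp add: int_independent_def)
    have "(\<lambda>x. x) \<in> hom (congruent_curve n \<rat>) E"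
      using Rats_subset_K by (auto simp: hom_def congruent_curve_def ec_group_def)
    hence SE: "int_independent E S"
      using int_independent_incl[OF comm_group_congruent_curve[OF subfield_Rats]
          comm_group_congruent_curve[OF subfield_K] _ SQ] S by blast
    show "\<exists>T. int_independent E T \<and> card T = card S + 2"
    proof (rule A.fixed_independent_extend[OF _ _ _ SE])
      show "A.orb P 1 (- 1) 0 \<in> carrier E" using P(2) by simp
      show "A.orb (A.orb P 1 (- 1) 0) 1 1 1 = \<one>\<^bsub>E\<^esub>"
        by (simp add: A.orb_trace_diff P(2))
      show "k = 0" if "A.orb P 1 (- 1) 0 [^]\<^bsub>E\<^esub> k = \<one>\<^bsub>E\<^esub>" for k :: int
        using conj_difference_nontorsion[OF P that] .
      show "map_ec_point \<sigma> a = a" if "a \<in> S" for a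
        using that SQ fixed_by_\<sigma> by blast
    qed
  qed
  thus ?thesis by (simp add: numeral_eq_enat)
qed

lemma rank_conjugates:
  assumes t: "t \<ge> - 1" and P: "P = Affine (r - 1) y" "P \<in> carrier E"
  defines "Q \<equiv> map_ec_point \<sigma> P" and "S \<equiv> map_ec_point \<sigma> (map_ec_point \<sigma> P)"
  shows "ab_rank (subgroup_generated E {P, Q, S}) = (if P \<otimes>\<^bsub>E\<^esub> Q \<otimes>\<^bsub>E\<^esub> S = \<one>\<^bsub>E\<^esub> then 2 else 3)"
proof -
  let ?H = "subgroup_generated E {P, Q, S}"
  have in_E: "P \<in> carrier E" "Q \<in> carrier E" "S \<in> carrier E" using P(2) by (simp_all add: Q_def S_def)
  have H: "comm_group ?H" by (rule A.abelian_subgroup_generated[OF A.comm_group_axioms])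
  have carrier_H: "carrier ?H = generate E {P, Q, S}"
    using in_E by (simp add: carrier_subgroup_generated Int_absorb1)
  have incl: "(\<lambda>x. x) \<in> hom ?H E"
    using A.carrier_subgroup_generated_subset by (auto simp: hom_def)
  have indep: "int_independent ?H T \<longleftrightarrow> T \<subseteq> generate E {P, Q, S} \<and> int_independent E T" for T
    using int_independent_incl[OF H A.comm_group_axioms incl, of T] carrier_H
    by (auto simp: int_independent_def)
  have tr: "A.orb P 1 1 1 = P \<otimes>\<^bsub>E\<^esub> Q \<otimes>\<^bsub>E\<^esub> S"
    using in_E by (simp add: A.orb_def Q_def S_def)
  show ?thesis
  proof (cases "P \<otimes>\<^bsub>E\<^esub> Q \<otimes>\<^bsub>E\<^esub> S = \<one>\<^bsub>E\<^esub>")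
    case True
    note tr1 = True[folded tr]
    have "P \<noteq> Q" "int_independent E {P, Q}"
      using A.orbit_independent_trace_one[OF P(2) tr1 P_nontorsion[OF P]] by (simp_all add: Q_def)
    have "inv\<^bsub>E\<^esub> S = P \<otimes>\<^bsub>E\<^esub> Q" using True in_E by (intro A.inv_equality) auto
    hence S: "S = inv\<^bsub>E\<^esub> (P \<otimes>\<^bsub>E\<^esub> Q)" using in_E by (metis A.inv_inv)
    have sub: "subgroup (generate E {P, Q}) E" using in_E by (intro A.generate_is_subgroup) auto
    have "P \<in> generate E {P, Q}" "Q \<in> generate E {P, Q}" by (auto intro: generate.incl)
    hence "{P, Q, S} \<subseteq> generate E {P, Q}"
      unfolding S using subgroup.m_closed[OF sub] subgroup.m_inv_closed[OF sub] by auto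
    hence gen: "generate E {P, Q, S} \<subseteq> generate E {P, Q}"
      by (rule A.generate_subgroup_incl[OF _ sub])
    have "ab_rank ?H = enat (card {P, Q})"
    proof (rule ab_rank_eqI)
      show "int_independent ?H {P, Q}"
        unfolding indep using \<open>int_independent E {P, Q}\<close> by (auto intro: generate.incl)
      fix T assume "int_independent ?H T"
      thus "card T \<le> card {P, Q}"
        unfolding indep using gen in_E by (intro A.int_independent_card_le) auto
    qed
    thus ?thesis using True \<open>P \<noteq> Q\<close> by (simp add: numeral_eq_enat)
  next
    case False
    have inf: "k = 0" if k: "A.orb P 1 1 1 [^]\<^bsub>E\<^esub> k = \<one>\<^bsub>E\<^esub>" for k :: int
    proof (rule ccontr)
      assume "k \<noteq> 0"
      from torsion_cases[OF _ k this] P(2) False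
      have "\<exists>e\<in>{0, N, - N}. P \<otimes>\<^bsub>E\<^esub> Q \<otimes>\<^bsub>E\<^esub> S = Affine e 0" unfolding tr[symmetric] by simp
      thus False using trace_not_two_torsion[OF t P] unfolding Q_def S_def by blast
    qed
    note 3 = A.orbit_independent[OF P(2) inf conj_difference_nontorsion[OF P], folded Q_def S_def, simplified]
    have "ab_rank ?H = enat (card {P, Q, S})"
    proof (rule ab_rank_eqI)
      show "int_independent ?H {P, Q, S}"
        unfolding indep using 3(2) by (auto intro: generate.incl simp: Q_def S_def)
      fix T assume "int_independent ?H T"
      thus "card T \<le> card {P, Q, S}"
        unfolding indep using in_E by (intro A.int_independent_card_le) auto
    qed
    thus ?thesis using False 3(1) by (simp add: numeral_eq_enat Q_def S_def)
  qed
qed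

end

theorem proposition7:
  fixes n :: rat and t :: int and y :: real and P :: "real ec_point"
  assumes "n > 0" and "t \<ge> -1"
    and "P = Affine (theta t - 1) y"
    and "P \<in> carrier (congruent_curve n (cubic_field t))"
  shows "group.ord (congruent_curve n (cubic_field t)) P = 0
    \<and> ab_rank (congruent_curve n (cubic_field t)) \<ge> ab_rank (congruent_curve n \<rat>) + 2
    \<and> ab_rank (subgroup_generated (congruent_curve n (cubic_field t))
                 {P, conjugate t P, conjugate t (conjugate t P)})
        = (if trace n t P = \<one>\<^bsub>congruent_curve n (cubic_field t)\<^esub> then 2 else 3)"
proof -
  interpret congruent_simplest_cubic t "theta t" n
    by (intro congruent_simplest_cubic.intro congruent_simplest_cubic_axioms.intro theta_root assms(1))
  note P = assms(3) assms(4)[unfolded sigma_eq(1)]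
  have "A.ord P = 0"
    using P_nontorsion[OF P, of "int (A.ord P)"] A.int_pow_eq_id[OF P(2)] by simp
  moreover note rank_growth[OF P] rank_conjugates[OF assms(2) P]
  ultimately show ?thesis
    by (simp add: sigma_eq conjugate_def trace_def Let_def)
qed

end
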